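(* Let $n\ge1$ and $k\in\{0,\dots,n\}$. Then the polynomials $\tau_2^{(k)}(x),\tau_4^{(k)}(x),\dots,\tau_{2n}^{(k)}(x)$ form a basis of invariants of the group $W_n$, i.e. they are algebraically independent homogeneous $W_n$-invariant polynomials generating the ring $\mathbb{R}[x_1,\dots,x_n]^{W_n}$ of $W_n$-invariant polynomials.
   Context: $W_n=S_n\ltimes\{\pm1\}^n$ acts on $\mathbb{R}^n$ by permuting coordinates and changing their signs (the symmetry group of the cube $[-1,1]^n$, of order $2^n n!$). For $j\ge1$ and $m\ge1$ let $H_m^{(j)}(t_1,\dots,t_j)=\sum t_1^{m_1}\cdots t_j^{m_j}$, the sum over all $(m_1,\dots,m_j)\in\mathbb{Z}_{\ge0}^j$ with $m_1+\cdots+m_j=m$. For $k=0,\dots,n$ put $h_m^{(k)}(x)=H_m^{(k+1)}(s_1,\dots,s_{k+1})$ where $s_i=x_i+x_{i+1}+\cdots+x_n$ for $1\le i\le n$ and $s_{n+1}=0$. Define $\tau_m^{(k)}(x)=\frac{1}{2^n n!}\sum_{\sigma\in W_n}h_m^{(k)}(\sigma x)$. *)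

theory Defs
  imports Complex_Main "HOL-Library.Poly_Mapping" "HOL-Library.FuncSet"
    "HOL-Combinatorics.Permutations"
begin

text \<open>
  Real polynomials in the variables x_1, x_2, ... are finitely supported maps from monomials
  (finitely supported exponent vectors) to coefficients; their ring structure, with convolution
  as multiplication, is that of \<^theory>\<open>HOL-Library.Poly_Mapping\<close>.
\<close>

type_synonym rpoly = "(nat \<Rightarrow>\<^sub>0 nat) \<Rightarrow>\<^sub>0 real"

definition Var :: "nat \<Rightarrow> rpoly"
  where "Var i = Poly_Mapping.single (Poly_Mapping.single i 1) 1"

definition Const :: "real \<Rightarrow> rpoly"
  where "Const c = Poly_Mapping.single 0 c"

definition vars :: "rpoly \<Rightarrow> nat set"
  where "vars p = (\<Union>m\<in>Poly_Mapping.keys p. Poly_Mapping.keys m)"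

definition poly_ring :: "nat \<Rightarrow> rpoly set"
  where "poly_ring n = {p. vars p \<subseteq> {1..n}}"

definition subst :: "(nat \<Rightarrow> rpoly) \<Rightarrow> rpoly \<Rightarrow> rpoly"
  where "subst f p = (\<Sum>m\<in>Poly_Mapping.keys p.
    Const (Poly_Mapping.lookup p m) *
      (\<Prod>i\<in>Poly_Mapping.keys m. f i ^ Poly_Mapping.lookup m i))"

definition monom_degree :: "(nat \<Rightarrow>\<^sub>0 nat) \<Rightarrow> nat"
  where "monom_degree m = (\<Sum>i\<in>Poly_Mapping.keys m. Poly_Mapping.lookup m i)"

definition homogeneous :: "rpoly \<Rightarrow> bool"
  where "homogeneous p \<longleftrightarrow> (\<exists>d. \<forall>m\<in>Poly_Mapping.keys p. monom_degree m = d)"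

text \<open>
  Elements of W_n are pairs of a permutation and a sign vector. The latter is an extensional
  function on \<open>{1..n}\<close>, so that distinct pairs are distinct group elements.
\<close>

definition W_group :: "nat \<Rightarrow> ((nat \<Rightarrow> nat) \<times> (nat \<Rightarrow> int)) set"
  where "W_group n = {\<pi>. \<pi> permutes {1..n}} \<times> ({1..n} \<rightarrow>\<^sub>E {1, -1})"

text \<open>The action on coordinate vectors; only the coordinates in \<open>{1..n}\<close> are meaningful.\<close>

definition W_act :: "(nat \<Rightarrow> nat) \<times> (nat \<Rightarrow> int) \<Rightarrow> (nat \<Rightarrow> 'a::comm_ring_1) \<Rightarrow> nat \<Rightarrow> 'a"
  where "W_act \<sigma> x = (\<lambda>i. of_int (snd \<sigma> i) * x (inv (fst \<sigma>) i))"

text \<open>The polynomial p(\<open>\<sigma>\<close>x).\<close>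

definition W_pullback :: "(nat \<Rightarrow> nat) \<times> (nat \<Rightarrow> int) \<Rightarrow> rpoly \<Rightarrow> rpoly"
  where "W_pullback \<sigma> p = subst (W_act \<sigma> Var) p"

definition W_invariants :: "nat \<Rightarrow> rpoly set"
  where "W_invariants n = {p \<in> poly_ring n. \<forall>\<sigma>\<in>W_group n. W_pullback \<sigma> p = p}"

definition H_poly :: "nat \<Rightarrow> nat \<Rightarrow> (nat \<Rightarrow> 'a::comm_ring_1) \<Rightarrow> 'a"
  where "H_poly j m t = (\<Sum>\<mu> | \<mu> \<in> {1..j} \<rightarrow>\<^sub>E UNIV \<and> (\<Sum>i=1..j. \<mu> i) = m. \<Prod>i=1..j. t i ^ \<mu> i)"

text \<open>For \<open>i = n + 1\<close> the inner sum is empty, which is the convention s_{n+1} = 0.\<close>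

definition h_poly :: "nat \<Rightarrow> nat \<Rightarrow> nat \<Rightarrow> rpoly"
  where "h_poly n k m = H_poly (k + 1) m (\<lambda>i. \<Sum>l=i..n. Var l)"

definition tau :: "nat \<Rightarrow> nat \<Rightarrow> nat \<Rightarrow> rpoly"
  where "tau n k m = Const (1 / (2 ^ n * fact n)) * (\<Sum>\<sigma>\<in>W_group n. W_pullback \<sigma> (h_poly n k m))"

definition algebraically_independent :: "nat \<Rightarrow> (nat \<Rightarrow> rpoly) \<Rightarrow> bool"
  where "algebraically_independent n f \<longleftrightarrow> (\<forall>q\<in>poly_ring n. subst f q = 0 \<longrightarrow> q = 0)"

inductive_set generated_algebra :: "rpoly set \<Rightarrow> rpoly set" for S
  where
    Const: "Const c \<in> generated_algebra S"
  | gen: "p \<in> S \<Longrightarrow> p \<in> generated_algebra S"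
  | add: "p \<in> generated_algebra S \<Longrightarrow> q \<in> generated_algebra S \<Longrightarrow> p + q \<in> generated_algebra S"
  | mult: "p \<in> generated_algebra S \<Longrightarrow> q \<in> generated_algebra S \<Longrightarrow> p * q \<in> generated_algebra S"

definition basis_of_invariants :: "nat \<Rightarrow> (nat \<Rightarrow> rpoly) \<Rightarrow> bool"
  where "basis_of_invariants n f \<longleftrightarrow>
    (\<forall>i\<in>{1..n}. homogeneous (f i) \<and> f i \<in> W_invariants n) \<and>
    algebraically_independent n f \<and>
    generated_algebra (f ` {1..n}) = W_invariants n"

end

theory Submission
  imports Defs "HOL-Computational_Algebra.Formal_Power_Series"
    "HOL-Computational_Algebra.Fundamental_Theorem_Algebra"
    "HOL-Combinatorics.Multiset_Permutations"
begin

text \<open>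
  Write y_i = x_i^2 and let P_r be the power sums of the y_i. The invariants are spanned by the
  symmetrized monomials in the y_i, and such a monomial of degree m whose support has s elements is
  (-1)^(s-1) (s-1)! (n-s)! P_m modulo the algebra generated by the P_r with r < m. Hence
  P_1, ..., P_n generate the invariants, and the claim reduces to the nonvanishing of the coefficient
  of P_m in \<open>\<tau>\<close>_(2m) for m = 1, ..., n: then the \<open>\<tau>\<close>_(2m), the P_m and the elementary symmetric
  polynomials of the y_i are related by invertible triangular substitutions, and independence
  follows since over the complex numbers the elementary symmetric polynomials take arbitrary values.

  Since h_m is up to a factor the integral of the m-th power of a linear form over a simplex, and
  these simplices triangulate a k-face of the cube, \<open>\<tau>\<close>_(2m) is up to a positive factor the degree 2m
  part of the symmetrization of sinh x_1 / x_1 ... sinh x_k / x_k cosh x_(k+1) ... cosh x_n. With a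
  variable u that marks the sinh factors, the coefficient of P_m becomes a positive multiple of
  the coefficient of u^k in (1 + u)^n [z^(2m)] log ((cosh z + u sinh z / z) / (1 + u)). Replacing z by
  iz turns its logarithmic derivative into a quotient involving only C = (1 - z cot z) / z^2, and the
  coefficients of C are positive by a Riccati equation.
\<close>

section \<open>Sums over flags of faces\<close>

text \<open>The logarithm comes from the weights: binomial(n, s) times (-1)^(s-1) (s-1)! (n-s)!
  equals (-1)^(s-1) n!/s, so grouping monomials by the size s of their support produces n! (1 + u)^n
  log(1 + Y/(1 + u)), where Y is the face series without its constant term 1 + u. The terms of this
  logarithm differ in sign, so nonvanishing cannot be read off term by term; after z is replaced by
  iz its derivative obeys a linear recursion with positive data, and positivity propagates. The
  logarithm itself never appears: since Y has no constant term, finite sums of powers suffice in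
  each degree. The integrals are replaced by an identity of power series whose proof divides by sums
  of subsets of the arguments. It is therefore used only at real points where no signed sum over a
  nonempty set of coordinates vanishes, and such points still determine a polynomial.\<close>

definition weak_comps :: "'a set \<Rightarrow> nat \<Rightarrow> ('a \<Rightarrow> nat) set"
  where "weak_comps A m = {\<mu> \<in> A \<rightarrow>\<^sub>E UNIV. sum \<mu> A = m}"

lemma finite_weak_comps [simp]:
  assumes "finite A"
  shows "finite (weak_comps A m)"
proof (rule finite_subset)
  show "weak_comps A m \<subseteq> A \<rightarrow>\<^sub>E {..m}"
    using assms by (auto simp: weak_comps_def PiE_iff extensional_def intro: member_le_sum)
qed (use assms in \<open>auto intro: finite_PiE\<close>)

lemma fps_prod_nth_weak_comps:
  fixes f :: "'a \<Rightarrow> 'b :: comm_ring_1 fps"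
  assumes "finite A"
  shows "fps_nth (\<Prod>i\<in>A. f i) m = (\<Sum>\<mu>\<in>weak_comps A m. \<Prod>i\<in>A. fps_nth (f i) (\<mu> i))"
  using assms
proof (induction A arbitrary: m rule: finite_induct)
  case empty
  have "weak_comps ({} :: 'a set) m = (if m = 0 then {\<lambda>_. undefined} else {})" for m :: nat
    by (auto simp: weak_comps_def)
  then show ?case by simp
next
  case (insert a A)
  have "(\<Sum>\<mu>\<in>weak_comps (insert a A) m. \<Prod>i\<in>insert a A. fps_nth (f i) (\<mu> i)) =
    (\<Sum>(j, \<mu>)\<in>Sigma {0..m} (\<lambda>j. weak_comps A (m - j)). fps_nth (f a) j * (\<Prod>i\<in>A. fps_nth (f i) (\<mu> i)))"
  proof (rule sum.reindex_bij_witness[of _ "\<lambda>(j, \<mu>). \<mu>(a := j)" "\<lambda>\<mu>. (\<mu> a, \<mu>(a := undefined))"])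
    fix \<mu> assume \<mu>: "\<mu> \<in> weak_comps (insert a A) m"
    have s: "sum (\<mu>(a := undefined)) A = sum \<mu> A"
      using insert.hyps by (intro sum.cong) auto
    show "(\<mu> a, \<mu>(a := undefined)) \<in> Sigma {0..m} (\<lambda>j. weak_comps A (m - j))"
      using \<mu> insert.hyps s by (auto simp: weak_comps_def PiE_iff extensional_def)
    have "(\<Prod>i\<in>A. fps_nth (f i) ((\<mu>(a := undefined)) i)) = (\<Prod>i\<in>A. fps_nth (f i) (\<mu> i))"
      using insert.hyps by (intro prod.cong) auto
    then show "(case (\<mu> a, \<mu>(a := undefined)) of
        (j, \<mu>) \<Rightarrow> fps_nth (f a) j * (\<Prod>i\<in>A. fps_nth (f i) (\<mu> i))) = (\<Prod>i\<in>insert a A. fps_nth (f i) (\<mu> i))"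
      using insert.hyps by simp
  next
    fix p assume p: "p \<in> Sigma {0..m} (\<lambda>j. weak_comps A (m - j))"
    obtain j \<mu> where [simp]: "p = (j, \<mu>)" by force
    have "sum (\<mu>(a := j)) A = sum \<mu> A"
      using insert.hyps by (intro sum.cong) auto
    then show "(case p of (j, \<mu>) \<Rightarrow> \<mu>(a := j)) \<in> weak_comps (insert a A) m"
      using p insert.hyps by (auto simp: weak_comps_def PiE_iff extensional_def)
    show "((case p of (j, \<mu>) \<Rightarrow> \<mu>(a := j)) a, (case p of (j, \<mu>) \<Rightarrow> \<mu>(a := j))(a := undefined)) = p"
      using p insert.hyps by (auto simp: weak_comps_def PiE_iff extensional_def)
  qed (auto simp: fun_eq_iff)
  also have "\<dots> = fps_nth (f a * (\<Prod>i\<in>A. f i)) m"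
    using insert.hyps by (simp add: fps_mult_nth insert.IH sum.Sigma[symmetric] sum_distrib_left)
  finally show ?case
    using insert.hyps by simp
qed

text \<open>\<open>geo t\<close> is the series 1/(1 - tX); the coefficients of products of these are the complete
  homogeneous symmetric polynomials. \<open>flag_series r [a\<^sub>1, \<dots>, a\<^sub>k]\<close> uses the arguments
  r + a_i + ... + a_k for i = 1, ..., k + 1.\<close>

definition geo :: "real \<Rightarrow> real fps"
  where "geo t = Abs_fps (\<lambda>n. t ^ n)"

fun flag_series :: "real \<Rightarrow> real list \<Rightarrow> real fps"
  where
    "flag_series r [] = geo r"
  | "flag_series r (x # xs) = geo (r + x + sum_list xs) * flag_series r xs"

lemma geo_mult: "(1 - fps_const t * fps_X) * geo t = 1"
proof (rule fps_ext)
  fix n show "fps_nth ((1 - fps_const t * fps_X) * geo t) n = fps_nth 1 n"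
    by (cases n) (auto simp: geo_def left_diff_distrib mult.assoc)
qed

lemma flag_series_snoc: "flag_series r (xs @ [z]) = flag_series (r + z) xs * geo r"
  by (induction xs) (auto simp: algebra_simps)

text \<open>Multiplying by 1 - rX cancels the last factor \<open>geo r\<close>, and multiplying by 1
  - (r + sum)X cancels the first one; the difference of these linear factors is sum times X. It is
  the divided difference recursion for complete homogeneous polynomials.\<close>

lemma flag_series_rec:
  assumes "xs \<noteq> []"
  shows "fps_const (sum_list xs) * fps_X * flag_series r xs =
    flag_series (r + last xs) (butlast xs) - flag_series r (tl xs)"
proof -
  have "(1 - fps_const r * fps_X) * flag_series r xs = flag_series (r + last xs) (butlast xs)"
  proof -
    have "flag_series r xs = flag_series r (butlast xs @ [last xs])"
      using assms by simp
    then have "(1 - fps_const r * fps_X) * flag_series r xs =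
        ((1 - fps_const r * fps_X) * geo r) * flag_series (r + last xs) (butlast xs)"
      by (simp only: flag_series_snoc mult_ac)
    then show ?thesis
      by (simp add: geo_mult)
  qed
  moreover have "(1 - fps_const (r + sum_list xs) * fps_X) * flag_series r xs = flag_series r (tl xs)"
  proof -
    obtain x ys where "xs = x # ys"
      using assms by (cases xs) auto
    then show ?thesis
      using geo_mult[of "r + sum_list xs"]
      by (simp add: add.assoc mult.assoc[symmetric])
  qed
  ultimately have "flag_series (r + last xs) (butlast xs) - flag_series r (tl xs) =
      ((1 - fps_const r * fps_X) - (1 - fps_const (r + sum_list xs) * fps_X)) * flag_series r xs"
    by (simp only: left_diff_distrib)
  also have "(1 - fps_const r * fps_X) - (1 - fps_const (r + sum_list xs) * fps_X) =
      fps_const (sum_list xs) * fps_X"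
    unfolding fps_const_add[symmetric] by (simp add: algebra_simps del: fps_const_add)
  finally show ?thesis ..
qed

text \<open>The series (exp(aX) - 1)/(aX), the integral of exp(ayX) over 0 \<le> y \<le> 1. Giving
  the coefficients avoids the quotient and covers a = 0.\<close>

definition expm1_div :: "real \<Rightarrow> real fps"
  where "expm1_div a = Abs_fps (\<lambda>n. a ^ n / fact (Suc n))"

lemma expm1_div: "fps_const a * fps_X * expm1_div a = fps_exp a - 1"
proof (rule fps_ext)
  fix n show "fps_nth (fps_const a * fps_X * expm1_div a) n = fps_nth (fps_exp a - 1) n"
    by (cases n) (auto simp: expm1_div_def mult.assoc simp del: fact_Suc)
qed

lemma sum_permutations_of_set_Cons:
  fixes f :: "'a list \<Rightarrow> 'b :: comm_monoid_add"
  assumes "finite T" "T \<noteq> {}"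
  shows "(\<Sum>xs\<in>permutations_of_set T. f xs) = (\<Sum>x\<in>T. \<Sum>ys\<in>permutations_of_set (T - {x}). f (x # ys))"
proof -
  have "(\<Sum>xs\<in>permutations_of_set T. f xs) =
      (\<Sum>x\<in>T. sum f ((\<lambda>ys. x # ys) ` permutations_of_set (T - {x})))"
    unfolding permutations_of_set_nonempty[OF assms(2)]
    using assms by (intro sum.UNION_disjoint) auto
  then show ?thesis
    by (simp add: sum.reindex inj_on_def)
qed

lemma sum_permutations_of_set_snoc:
  fixes f :: "'a list \<Rightarrow> 'b :: comm_monoid_add"
  assumes "finite T" "T \<noteq> {}"
  shows "(\<Sum>xs\<in>permutations_of_set T. f xs) = (\<Sum>x\<in>T. \<Sum>ys\<in>permutations_of_set (T - {x}). f (ys @ [x]))"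
proof -
  have r: "(\<Sum>xs\<in>permutations_of_set S. g (rev xs)) = (\<Sum>xs\<in>permutations_of_set S. g xs)"
    for S and g :: "'a list \<Rightarrow> 'b"
    using sum.reindex[of rev "permutations_of_set S" g] by simp
  have "(\<Sum>xs\<in>permutations_of_set T. f xs) = (\<Sum>xs\<in>permutations_of_set T. f (rev xs))"
    by (rule r[symmetric])
  also have "\<dots> = (\<Sum>x\<in>T. \<Sum>ys\<in>permutations_of_set (T - {x}). f (rev ys @ [x]))"
    by (simp add: sum_permutations_of_set_Cons[OF assms])
  also have "\<dots> = (\<Sum>x\<in>T. \<Sum>ys\<in>permutations_of_set (T - {x}). f (ys @ [x]))"
    by (intro sum.cong refl r)
  finally show ?thesis .
qed

text \<open>Up to the factor m!, the right-hand side is the integral of (r + \<open>\<Sum>\<close> a_i y_i)^m over the unit cube,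
  and the left-hand side sums the contributions of the simplices y_{i_1} \<open>\<le>\<close> ... \<open>\<le>\<close> y_{i_k}
  that triangulate it. Cancelling the sum of the a_i needs these sums to be nonzero.\<close>

lemma sum_flag_series_nth:
  fixes a :: "'a \<Rightarrow> real"
  assumes "finite T" and "\<And>S. S \<subseteq> T \<Longrightarrow> S \<noteq> {} \<Longrightarrow> sum a S \<noteq> 0"
  shows "(\<Sum>xs\<in>permutations_of_set T. fps_nth (flag_series r (map a xs)) m) =
    fact (m + card T) * fps_nth (fps_exp r * (\<Prod>i\<in>T. expm1_div (a i))) m"
  using assms
proof (induction T arbitrary: r m rule: finite_psubset_induct)
  case (psubset T)
  show ?case
  proof (cases "T = {}")
    case True
    then show ?thesis by (simp add: geo_def)
  next
    case False
    let ?F = "\<lambda>S r. \<Sum>xs\<in>permutations_of_set S. flag_series r (map a xs)"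
    have sl: "sum_list (map a xs) = sum a T" if "xs \<in> permutations_of_set T" for xs
      using that by (metis permutations_of_setD sum_list_distinct_conv_sum_set)
    have ne: "map a xs \<noteq> []" if "xs \<in> permutations_of_set T" for xs
      using that False by (auto simp: permutations_of_set_def)
    have "fps_const (sum a T) * fps_X * ?F T r =
        (\<Sum>xs\<in>permutations_of_set T. fps_const (sum_list (map a xs)) * fps_X * flag_series r (map a xs))"
      unfolding sum_distrib_left by (intro sum.cong refl) (simp add: sl)
    also have "\<dots> = (\<Sum>xs\<in>permutations_of_set T.
        flag_series (r + last (map a xs)) (butlast (map a xs)) - flag_series r (tl (map a xs)))"
      by (intro sum.cong refl flag_series_rec ne)
    \<comment> \<open>The first term is grouped by the last entry of the list, the second by the
      first entry. Both become sums over \<open>T - {i}\<close>, and only in the first is the base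
      shifted by \<open>a i\<close>.\<close>
    also have "\<dots> = (\<Sum>i\<in>T. ?F (T - {i}) (r + a i)) - (\<Sum>i\<in>T. ?F (T - {i}) r)"
      unfolding sum_subtractf
      by (subst sum_permutations_of_set_snoc[OF psubset.hyps(1) False],
          subst sum_permutations_of_set_Cons[OF psubset.hyps(1) False])
         (simp add: map_butlast[symmetric])
    finally have eq: "fps_const (sum a T) * fps_X * ?F T r =
        (\<Sum>i\<in>T. ?F (T - {i}) (r + a i) - ?F (T - {i}) r)"
      by (simp add: sum_subtractf)
    \<comment> \<open>The factor X raises the coefficient index by one while the set loses one
      element, so the induction hypothesis already carries the factorial belonging to
      \<open>T\<close>.\<close>
    have card: "Suc m + card (T - {i}) = m + card T" if "i \<in> T" for i
      using that psubset.hyps(1) by (simp add: card_Diff_singleton) (metis Suc_pred add_Suc_right card_gt_0_iff empty_iff)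
    have IH: "fps_nth (?F (T - {i}) s) (Suc m) = fact (m + card T) *
        fps_nth (fps_exp s * (\<Prod>l\<in>T - {i}. expm1_div (a l))) (Suc m)" if "i \<in> T" for i s
      using psubset.IH[of "T - {i}" s "Suc m"] that psubset.prems card[OF that]
      by (auto simp: fps_sum_nth)
    \<comment> \<open>The difference of the two exponentials supplies the factor
      \<open>expm1_div (a i)\<close> that is missing from the product over
      \<open>T - {i}\<close>.\<close>
    have factor: "fps_exp (r + a i) * P - fps_exp r * P = fps_exp r * (fps_const (a i) * fps_X) * (expm1_div (a i) * P)"
      for i P
    proof -
      have "fps_exp (r + a i) * P - fps_exp r * P = fps_exp r * (fps_exp (a i) - 1) * P"
        by (simp add: fps_exp_add_mult algebra_simps)
      then show ?thesis
        by (simp add: expm1_div[symmetric] mult_ac)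
    qed
    let ?P = "fps_exp r * (\<Prod>i\<in>T. expm1_div (a i))"
    have "sum a T * fps_nth (?F T r) m = fps_nth (fps_const (sum a T) * fps_X * ?F T r) (Suc m)"
      by (simp add: mult.assoc)
    also have "\<dots> = (\<Sum>i\<in>T. fps_nth (?F (T - {i}) (r + a i)) (Suc m) - fps_nth (?F (T - {i}) r) (Suc m))"
      unfolding eq by (simp add: fps_sum_nth)
    also have "\<dots> = (\<Sum>i\<in>T. fact (m + card T) * fps_nth
        (fps_exp (r + a i) * (\<Prod>l\<in>T - {i}. expm1_div (a l)) - fps_exp r * (\<Prod>l\<in>T - {i}. expm1_div (a l))) (Suc m))"
      by (intro sum.cong refl) (simp only: IH fps_sub_nth right_diff_distrib)
    also have "\<dots> = (\<Sum>i\<in>T. fact (m + card T) * (a i * fps_nth ?P m))"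
    proof (intro sum.cong refl)
      fix i assume "i \<in> T"
      then have "(\<Prod>i\<in>T. expm1_div (a i)) = expm1_div (a i) * (\<Prod>l\<in>T - {i}. expm1_div (a l))"
        using psubset.hyps(1) by (simp add: prod.remove)
      then have "fps_exp (r + a i) * (\<Prod>l\<in>T - {i}. expm1_div (a l)) - fps_exp r * (\<Prod>l\<in>T - {i}. expm1_div (a l))
          = fps_const (a i) * (fps_X * ?P)"
        unfolding factor by (simp add: mult_ac)
      then show "fact (m + card T) * fps_nth
        (fps_exp (r + a i) * (\<Prod>l\<in>T - {i}. expm1_div (a l)) - fps_exp r * (\<Prod>l\<in>T - {i}. expm1_div (a l))) (Suc m)
        = fact (m + card T) * (a i * fps_nth ?P m)"
        by simp
    qed
    also have "\<dots> = sum a T * (fact (m + card T) * fps_nth ?P m)"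
      by (simp add: sum_distrib_right sum_distrib_left mult_ac)
    finally show ?thesis
      using psubset.prems[of T] False by (simp add: fps_sum_nth)
  qed
qed

section \<open>Nonvanishing of the logarithmic coefficients\<close>

definition cos_sqrt :: "real fps"
  where "cos_sqrt = Abs_fps (\<lambda>j. (-1) ^ j / fact (2 * j))"

definition sinc_sqrt :: "real fps"
  where "sinc_sqrt = Abs_fps (\<lambda>j. (-1) ^ j / fact (2 * j + 1))"

text \<open>The series (1 - z cot z) / z^2 in the variable y = z^2.\<close>

definition cot_series :: "real fps"
  where "cot_series = fps_shift 1 (1 - cos_sqrt * inverse sinc_sqrt)"

lemma cos_sqrt_eq: "cos_sqrt = (1 - fps_X * cot_series) * sinc_sqrt"
proof -
  have nz: "fps_nth sinc_sqrt 0 \<noteq> 0"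
    by (simp add: sinc_sqrt_def)
  have "fps_nth (1 - cos_sqrt * inverse sinc_sqrt) 0 = 0"
    by (simp add: cos_sqrt_def sinc_sqrt_def)
  then have "fps_X * cot_series = 1 - cos_sqrt * inverse sinc_sqrt"
    unfolding cot_series_def by (intro fps_ext) (auto simp: fps_X_mult_nth split: nat.splits)
  then show ?thesis
    by (simp add: mult.assoc inverse_mult_eq_1[OF nz])
qed

text \<open>With y = z^2, d/dy is (1/(2z)) d/dz, which takes cos z to -(sin z)/(2z).\<close>

lemma deriv_cos_sqrt: "fps_deriv cos_sqrt = fps_const (-1/2) * sinc_sqrt"
proof (rule fps_ext)
  fix j
  have "fact (2 * Suc j) = 2 * real (Suc j) * fact (2 * j + 1)"
    by (simp add: algebra_simps)
  moreover have "a * (- c / (2 * a * b)) = -1/2 * (c / b)" if "a \<noteq> 0" for a b c :: real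
    using that by simp
  ultimately show "fps_nth (fps_deriv cos_sqrt) j = fps_nth (fps_const (-1/2) * sinc_sqrt) j"
    unfolding cos_sqrt_def sinc_sqrt_def
    by (simp only: fps_deriv_nth fps_nth_Abs_fps fps_mult_left_const_nth power_Suc Suc_eq_plus1[symmetric]
        mult_minus1 of_nat_eq_0_iff nat.distinct simp_thms)
qed

text \<open>In the variable y = z^2, 2y d/dy (sin z / z) = cos z - sin z / z. The right-hand side is
  -yC sin z / z by the choice of C, and y cancels.\<close>

lemma deriv_sinc_sqrt: "fps_deriv sinc_sqrt = fps_const (-1/2) * cot_series * sinc_sqrt"
proof -
  have "fps_const 2 * (fps_X * fps_deriv sinc_sqrt) = cos_sqrt - sinc_sqrt"
  proof (rule fps_ext)
    fix j
    have "fps_nth (fps_X * fps_deriv sinc_sqrt) j = real j * fps_nth sinc_sqrt j"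
      by (cases j) simp_all
    moreover have "fact (2 * j + 1) = (2 * real j + 1) * fact (2 * j)"
      by (simp add: algebra_simps)
    moreover have "2 * (x * (c / ((2 * x + 1) * b))) = c / b - c / ((2 * x + 1) * b)"
      if "2 * x + 1 \<noteq> 0" for x b c :: real
    proof -
      have "c / b = ((2 * x + 1) * c) / ((2 * x + 1) * b)"
        using that by simp
      then have "c / b - c / ((2 * x + 1) * b) = ((2 * x + 1) * c - c) / ((2 * x + 1) * b)"
        by (simp only: diff_divide_distrib)
      then show ?thesis
        by (simp add: algebra_simps)
    qed
    ultimately show "fps_nth (fps_const 2 * (fps_X * fps_deriv sinc_sqrt)) j = fps_nth (cos_sqrt - sinc_sqrt) j"
      unfolding cos_sqrt_def sinc_sqrt_def by (simp del: fact_Suc)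
  qed
  also have "\<dots> = fps_X * (- (cot_series * sinc_sqrt))"
    by (subst cos_sqrt_eq) (simp add: algebra_simps)
  finally have "fps_X * (fps_const 2 * fps_deriv sinc_sqrt) = fps_X * (- (cot_series * sinc_sqrt))"
    by (simp add: mult_ac)
  then have "fps_const 2 * fps_deriv sinc_sqrt = - (cot_series * sinc_sqrt)"
    by (simp only: mult_cancel_left fps_X_neq_zero simp_thms)
  then have "fps_const (1/2) * (fps_const 2 * fps_deriv sinc_sqrt) =
      fps_const (1/2) * (- (cot_series * sinc_sqrt))"
    by (simp only:)
  moreover have "fps_const (-1/2) = - (fps_const (1/2) :: real fps)"
    by (simp add: fps_eq_iff)
  ultimately show ?thesis
    by (simp add: mult.assoc[symmetric] del: fps_const_neg)
qed

text \<open>This is cot' = -1 - cot^2 in the variable y: differentiate cos z = (1 - yC) sin z / z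
  and cancel the nonzero series sin z / z.\<close>

lemma cot_series_riccati:
  "fps_const 3 * cot_series + fps_const 2 * (fps_X * fps_deriv cot_series) = 1 + fps_X * cot_series ^ 2"
proof -
  let ?C = cot_series and ?S = sinc_sqrt and ?h = "fps_const (1/2) :: real fps"
  have nz: "?S \<noteq> 0"
    by (auto simp: sinc_sqrt_def fps_eq_iff intro!: exI[of _ 0])
  have two: "fps_const 2 * ?h = 1" "fps_const (-1/2) = - ?h" "fps_const 3 = fps_const 2 + (1 :: real fps)"
    by (simp_all add: fps_eq_iff)
  have "fps_const (-1/2) * ?S = fps_deriv ((1 - fps_X * ?C) * ?S)"
    by (simp add: cos_sqrt_eq[symmetric] deriv_cos_sqrt)
  also have "\<dots> = (- ?C - fps_X * fps_deriv ?C) * ?S + (1 - fps_X * ?C) * (fps_const (-1/2) * ?C * ?S)"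
    by (simp add: deriv_sinc_sqrt algebra_simps)
  finally have "(- ?h) * ?S = ((- ?C - fps_X * fps_deriv ?C) + (1 - fps_X * ?C) * (- ?h * ?C)) * ?S"
    unfolding two by (simp add: algebra_simps)
  then have "- ?h = (- ?C - fps_X * fps_deriv ?C) + (1 - fps_X * ?C) * (- ?h * ?C)"
    using nz by (metis mult_right_cancel)
  then have "?h = ?C + fps_X * fps_deriv ?C + (1 - fps_X * ?C) * (?h * ?C)"
    by (simp add: algebra_simps del: fps_const_neg)
  then have "fps_const 2 * ?h = fps_const 2 * (?C + fps_X * fps_deriv ?C + (1 - fps_X * ?C) * (?h * ?C))"
    by (simp only:)
  also have "\<dots> = fps_const 2 * ?C + fps_const 2 * (fps_X * fps_deriv ?C) + (fps_const 2 * ?h) * ((1 - fps_X * ?C) * ?C)"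
    by (simp only: algebra_simps)
  finally show ?thesis
    unfolding two by (simp add: algebra_simps power2_eq_square)
qed

text \<open>The Riccati equation gives (3 + 2j) c_j as the sum of c_a c_b over a + b = j - 1, plus 1
  if j = 0: a recursion without subtraction.\<close>

lemma cot_series_pos: "fps_nth cot_series j > 0"
proof (induction j rule: less_induct)
  case (less j)
  have eq: "(3 + 2 * real j) * fps_nth cot_series j = fps_nth (1 + fps_X * cot_series ^ 2) j"
    unfolding cot_series_riccati[symmetric]
    by (cases j) (simp_all add: algebra_simps)
  have "fps_nth (1 + fps_X * cot_series ^ 2) j > 0"
  proof (cases j)
    case (Suc i)
    have "fps_nth (cot_series ^ 2) i > 0"
      unfolding power2_eq_square fps_mult_nth
      by (intro sum_pos mult_pos_pos less.IH) (auto simp: Suc)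
    then show ?thesis
      by (simp add: Suc)
  qed simp
  then have "(3 + 2 * real j) * fps_nth cot_series j > 0"
    using eq by simp
  then show ?case
    by (simp add: zero_less_mult_iff)
qed

text \<open>The variable of the coefficient polynomials is u, and \<open>fps_scale F\<close> is F((1 + u)y).\<close>

definition one_u :: "real poly"
  where "one_u = [:1, 1:]"

definition fps_scale :: "real fps \<Rightarrow> real poly fps"
  where "fps_scale F = Abs_fps (\<lambda>j. smult (fps_nth F j) (one_u ^ j))"

lemma one_u_nonzero [simp]: "one_u \<noteq> 0"
  by (simp add: one_u_def)

lemma fps_scale_nth [simp]: "fps_nth (fps_scale F) j = smult (fps_nth F j) (one_u ^ j)"
  by (simp add: fps_scale_def)

lemma fps_scale_mult: "fps_scale (F * G) = fps_scale F * fps_scale G"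
proof (rule fps_ext)
  fix j
  have "fps_nth (fps_scale F * fps_scale G) j = (\<Sum>i=0..j. smult (fps_nth F i * fps_nth G (j - i)) (one_u ^ j))"
    unfolding fps_mult_nth by (intro sum.cong refl) (simp add: power_add[symmetric] mult.commute)
  then show "fps_nth (fps_scale (F * G)) j = fps_nth (fps_scale F * fps_scale G) j"
    by (simp add: fps_mult_nth smult_sum)
qed

lemma fps_scale_diff: "fps_scale (F - G) = fps_scale F - fps_scale G"
  by (rule fps_ext) (simp add: smult_diff_left)

lemma fps_scale_1: "fps_scale 1 = 1"
  by (rule fps_ext) simp

lemma fps_scale_const: "fps_scale (fps_const c) = fps_const [:c:]"
  by (rule fps_ext) simp

lemma fps_scale_X: "fps_scale fps_X = fps_const one_u * fps_X"
  by (rule fps_ext) (auto simp: le_Suc_eq)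

lemma fps_deriv_scale: "fps_deriv (fps_scale F) = fps_const one_u * fps_scale (fps_deriv F)"
  by (rule fps_ext) (simp add: of_nat_poly algebra_simps)

text \<open>In the variables y = z^2 and u, this is (cos z + u sin z / z) / (1 + u) with y replaced
  by (1 + u)y, which makes the coefficients polynomials in u.\<close>

definition mixed_series :: "real poly fps"
  where "mixed_series = Abs_fps (\<lambda>j. if j = 0 then 1
    else (-1) ^ j * [:1 / fact (2 * j), 1 / fact (2 * j + 1):] * one_u ^ (j - 1))"

lemma mixed_series_nth_pos:
  assumes "j > 0"
  shows "one_u * fps_nth mixed_series j = (-1) ^ j * (one_u ^ j * [:1 / fact (2 * j), 1 / fact (2 * j + 1):])"
proof -
  have "one_u ^ j = one_u * one_u ^ (j - 1)"
    using assms by (cases j) auto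
  moreover have "fps_nth mixed_series j =
      (-1) ^ j * [:1 / fact (2 * j), 1 / fact (2 * j + 1):] * one_u ^ (j - 1)"
    using assms by (simp only: mixed_series_def fps_nth_Abs_fps neq0_conv if_not_P)
  ultimately show ?thesis
    by (simp only: mult_ac)
qed

lemma scaled_mixed_series:
  "fps_const one_u * mixed_series = fps_scale cos_sqrt + fps_const [:0, 1:] * fps_scale sinc_sqrt"
proof (rule fps_ext)
  fix j
  have c: "(-1) ^ j * p = smult ((-1) ^ j) p" for p :: "real poly"
    by (cases "even j") auto
  show "fps_nth (fps_const one_u * mixed_series) j =
    fps_nth (fps_scale cos_sqrt + fps_const [:0, 1:] * fps_scale sinc_sqrt) j"
  proof (cases "j = 0")
    case True
    then show ?thesis
      by (simp add: mixed_series_def cos_sqrt_def sinc_sqrt_def one_u_def)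
  next
    case False
    then have "fps_nth (fps_const one_u * mixed_series) j =
        smult ((-1) ^ j) (one_u ^ j * [:1 / fact (2 * j), 1 / fact (2 * j + 1):])"
      by (simp only: fps_mult_left_const_nth mixed_series_nth_pos c neq0_conv)
    then show ?thesis
      by (simp add: cos_sqrt_def sinc_sqrt_def algebra_simps smult_add_right del: fact_Suc mult_Suc_right)
  qed
qed

text \<open>Rescaling turns cos z into (1 - (1 + u)yC) sin z / z, with C and the sine rescaled as
  well. Adding u sin z / z makes the first factor (1 + u)(1 - yC), so the denominator 1 + u
  cancels.\<close>

lemma mixed_series_eq: "mixed_series = (1 - fps_X * fps_scale cot_series) * fps_scale sinc_sqrt"
proof -
  have "fps_const one_u * mixed_series =
      (1 + fps_const [:0, 1:] - fps_const one_u * fps_X * fps_scale cot_series) * fps_scale sinc_sqrt"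
    unfolding scaled_mixed_series cos_sqrt_eq
    by (simp add: fps_scale_mult fps_scale_diff fps_scale_1 fps_scale_X algebra_simps)
  also have "1 + fps_const [:0, 1:] = fps_const one_u"
    by (simp add: one_u_def fps_eq_iff one_pCons)
  finally have "fps_const one_u * mixed_series =
      fps_const one_u * ((1 - fps_X * fps_scale cot_series) * fps_scale sinc_sqrt)"
    by (simp add: algebra_simps)
  then show ?thesis
    by simp
qed

text \<open>Both derivatives are multiples of sin z / z, and the chain rule contributes the factor 1
  + u that the normalization divides out. The quotient by \<open>mixed_series\<close> is therefore
  (1 + uC)/(2(1 - yC)), free of the sine.\<close>

lemma deriv_mixed_series:
  "- fps_deriv mixed_series =
    fps_const [:1/2:] * (1 + fps_const [:0, 1:] * fps_scale cot_series) * fps_scale sinc_sqrt"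
proof -
  have "fps_const one_u * fps_deriv mixed_series = fps_deriv (fps_const one_u * mixed_series)"
    by simp
  also have "\<dots> = fps_const one_u * (fps_scale (fps_deriv cos_sqrt) + fps_const [:0, 1:] * fps_scale (fps_deriv sinc_sqrt))"
    unfolding scaled_mixed_series by (simp add: fps_deriv_scale algebra_simps)
  finally have "fps_deriv mixed_series =
      fps_scale (fps_deriv cos_sqrt) + fps_const [:0, 1:] * fps_scale (fps_deriv sinc_sqrt)"
    by simp
  moreover have "fps_const [:-(1/2):] = - (fps_const [:1/2:] :: real poly fps)"
    by (simp add: fps_eq_iff)
  ultimately have "fps_deriv mixed_series =
      - (fps_const [:1/2:] * (1 + fps_const [:0, 1:] * fps_scale cot_series) * fps_scale sinc_sqrt)"
    unfolding deriv_cos_sqrt deriv_sinc_sqrt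
    by (simp add: fps_scale_mult fps_scale_const algebra_simps del: fps_const_mult fps_const_neg)
  then show ?thesis
    by simp
qed

text \<open>Strict positivity is what nonvanishing for each face dimension requires. Nonnegativity
  of the other coefficients makes the property stable under sums and under multiplication by 1 + u,
  which lengthens the strict range by one.\<close>

definition pos_upto :: "nat \<Rightarrow> real poly \<Rightarrow> bool"
  where "pos_upto d p \<longleftrightarrow> (\<forall>k. coeff p k \<ge> 0) \<and> (\<forall>k\<le>d. coeff p k > 0)"

lemma pos_upto_one_u: "pos_upto d p \<Longrightarrow> pos_upto (Suc d) (one_u * p)"
proof -
  assume p: "pos_upto d p"
  have "coeff (one_u * p) k = coeff p k + (if k = 0 then 0 else coeff p (k - 1))" for k
    by (cases k) (simp_all add: one_u_def)
  moreover have "coeff p k + coeff p (k - 1) > 0" if "0 < k" "k \<le> Suc d" for k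
    using p that by (intro add_nonneg_pos) (auto simp: pos_upto_def)
  ultimately show ?thesis
    using p by (auto simp: pos_upto_def)
qed

lemma pos_upto_one_u_power: "pos_upto d p \<Longrightarrow> pos_upto (d + e) (one_u ^ e * p)"
  by (induction e) (auto simp: mult.assoc dest: pos_upto_one_u)

lemma pos_upto_one_u_power': "pos_upto e (one_u ^ e)"
  using pos_upto_one_u_power[of 0 1 e] by (auto simp: pos_upto_def coeff_1)

lemma pos_upto_add: "pos_upto d p \<Longrightarrow> \<forall>k. coeff q k \<ge> 0 \<Longrightarrow> pos_upto d (p + q)"
  by (auto simp: pos_upto_def add_pos_nonneg)

lemma coeff_mult_nonneg:
  fixes p q :: "real poly"
  shows "\<forall>k. coeff p k \<ge> 0 \<Longrightarrow> \<forall>k. coeff q k \<ge> 0 \<Longrightarrow> coeff (p * q) k \<ge> 0"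
  by (auto simp: coeff_mult intro!: sum_nonneg)

text \<open>For the partial sums of the logarithmic derivative the identity
  (logarithmic derivative) * (1 - yC) = (1 + uC) / 2 holds up to order m; its solution
  has positive coefficients because C has.\<close>

lemma log_deriv_pos:
  assumes "j < m"
  shows "pos_upto (Suc j) (fps_nth ((\<Sum>s<m. (1 - mixed_series) ^ s) * (- fps_deriv mixed_series)) j)"
proof -
  let ?Z = "1 - mixed_series" and ?C = "fps_scale cot_series" and ?S = "fps_scale sinc_sqrt"
  define Q where "Q = (\<Sum>s<m. ?Z ^ s) * (- fps_deriv mixed_series)"
  define N where "N = fps_const [:1/2:] * (1 + fps_const [:0, 1:] * ?C)"
  have Z0: "fps_nth ?Z 0 = 0"
    by (simp add: mixed_series_def)
  have "fps_nth ?S 0 \<noteq> 0"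
    by (simp add: sinc_sqrt_def)
  then have S: "?S \<noteq> 0"
    by (metis fps_zero_nth)
  \<comment> \<open>The finite geometric sum stands in for the inverse of
    \<open>mixed_series\<close>, with error \<open>?Z ^ m\<close>.\<close>
  have "(\<Sum>s<m. ?Z ^ s) * mixed_series = 1 - ?Z ^ m"
    using one_diff_power_eq[of ?Z m] by (simp add: mult.commute)
  then have "Q * mixed_series = (- fps_deriv mixed_series) * (1 - ?Z ^ m)"
    unfolding Q_def by (metis mult.assoc mult.commute)
  then have "(Q * (1 - fps_X * ?C)) * ?S = (N * (1 - ?Z ^ m)) * ?S"
    unfolding deriv_mixed_series N_def by (subst (asm) mixed_series_eq) (simp add: mult_ac)
  then have eq: "Q * (1 - fps_X * ?C) = N * (1 - ?Z ^ m)"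
    using S by simp
  have "pos_upto (Suc j) (fps_nth Q j)" if "j < m" for j
    using that
  proof (induction j rule: less_induct)
    case (less j)
    \<comment> \<open>\<open>?Z\<close> has no constant term, so \<open>?Z ^ m\<close> starts in
      order m and the error is invisible at all indices below m.\<close>
    have Zm: "fps_nth (?Z ^ m) i = 0" if "i \<le> j" for i
      using startsby_zero_power_prefix[OF Z0] less.prems that by auto
    have "fps_nth (N * ?Z ^ m) j = 0"
      unfolding fps_mult_nth by (intro sum.neutral) (auto simp: Zm)
    then have "fps_nth (Q * (1 - fps_X * ?C)) j = fps_nth N j"
      unfolding eq by (simp add: algebra_simps)
    then have "fps_nth Q j = fps_nth N j + fps_nth (fps_X * (?C * Q)) j"
      by (simp add: algebra_simps)
    moreover have N: "fps_nth N j = [:1/2:] * ((if j = 0 then 1 else 0) +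
        pCons 0 (smult (fps_nth cot_series j) (one_u ^ j)))"
      by (simp add: N_def)
    ultimately have Q: "fps_nth Q j = [:1/2:] * ((if j = 0 then 1 else 0) +
        pCons 0 (smult (fps_nth cot_series j) (one_u ^ j))) + fps_nth (fps_X * (?C * Q)) j"
      by simp
    have v: "coeff (one_u ^ j) k > 0" if "k \<le> j" for k j
      using pos_upto_one_u_power'[of j] that by (auto simp: pos_upto_def)
    have v0: "coeff (one_u ^ j) k \<ge> 0" for k j
      using pos_upto_one_u_power'[of j] by (auto simp: pos_upto_def)
    show ?case
    proof (cases j)
      case 0
      have "fps_nth Q 0 = [:1/2:] * (1 + pCons 0 [:fps_nth cot_series 0:])"
        using Q by (simp add: 0)
      then show ?thesis
        using cot_series_pos[of 0] by (auto simp: 0 pos_upto_def coeff_pCons one_pCons le_Suc_eq split: nat.splits)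
    next
      case (Suc i)
      have IH: "pos_upto (Suc l) (fps_nth Q l)" if "l \<le> i" for l
        using less.IH[of l] less.prems that Suc by simp
      have Cnn: "\<forall>k. coeff (fps_nth ?C l) k \<ge> 0" for l
        using v0 cot_series_pos[of l] by (simp add: less_imp_le)
      \<comment> \<open>The term l = 0 alone gives strict positivity: \<open>fps_nth ?C 0\<close> is
        a positive constant and \<open>fps_nth Q i\<close> is strictly positive up to u^j. The other
        terms only have to be nonnegative.\<close>
      have "fps_nth (?C * Q) i = fps_nth ?C 0 * fps_nth Q i + (\<Sum>l=Suc 0..i. fps_nth ?C l * fps_nth Q (i - l))"
        by (simp add: fps_mult_nth sum.atLeast_Suc_atMost)
      moreover have "pos_upto j (fps_nth ?C 0 * fps_nth Q i)"
        using IH[of i] cot_series_pos[of 0] by (simp add: pos_upto_def Suc)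
      moreover have "\<forall>k. coeff (\<Sum>l=Suc 0..i. fps_nth ?C l * fps_nth Q (i - l)) k \<ge> 0"
        unfolding coeff_sum
      proof (rule allI, rule sum_nonneg, rule coeff_mult_nonneg[OF Cnn])
        fix l show "\<forall>k. coeff (fps_nth Q (i - l)) k \<ge> 0"
          using IH[of "i - l"] by (simp add: pos_upto_def)
      qed
      ultimately have A: "pos_upto j (fps_nth (?C * Q) i)"
        by (simp add: pos_upto_add)
      have Qj: "coeff (fps_nth Q j) k = (case k of 0 \<Rightarrow> 0 | Suc k' \<Rightarrow> fps_nth cot_series j * coeff (one_u ^ j) k' / 2)
          + coeff (fps_nth (?C * Q) i) k" for k
        using arg_cong[OF Q, of "\<lambda>p. coeff p k"] unfolding Suc
        by (simp add: coeff_pCons del: power_Suc split: nat.splits)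
      have c: "fps_nth cot_series j * coeff (one_u ^ j) k \<ge> 0" for k
        using v0 cot_series_pos[of j] by (simp add: less_imp_le)
      have "coeff (fps_nth Q j) k \<ge> 0" for k
        using c A unfolding Qj by (auto simp: pos_upto_def intro!: add_nonneg_nonneg split: nat.splits)
      moreover have "coeff (fps_nth Q j) k > 0" if "k \<le> Suc j" for k
      proof (cases "k \<le> j")
        case True
        then show ?thesis
          using c A unfolding Qj by (auto simp: pos_upto_def intro!: add_nonneg_pos split: nat.splits)
      next
        \<comment> \<open>The power u^(j+1) lies beyond the strict range known for
          \<open>?C * Q\<close>. It comes from the summand uC of the inhomogeneous term, through the
          leading coefficient of (1 + u)^j.\<close>
        case False
        then have "k = Suc j"
          using that by simp
        then show ?thesis
          using v[of j j] cot_series_pos[of j] A unfolding Qj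
          by (auto simp: pos_upto_def intro!: add_pos_nonneg)
      qed
      ultimately show ?thesis
        by (simp add: pos_upto_def)
    qed
  qed
  from this[OF assms] show ?thesis
    by (simp add: Q_def)
qed

lemma smult_sum_right: "smult c (\<Sum>i\<in>A. f i) = (\<Sum>i\<in>A. smult c (f i))"
  by (induction A rule: infinite_finite_induct) (simp_all add: smult_add_right)

text \<open>The sum is the coefficient of y^m in -log \<open>mixed_series\<close>, where s stops at
  m because Z = 1 - \<open>mixed_series\<close> has no constant term. Multiplication by m amounts to
  differentiation, m [y^m] Z^s / s = [y^(m-1)] Z^(s-1) Z', and leads to the truncated logarithmic
  derivative.\<close>

lemma log_series_pos:
  assumes "1 \<le> m"
  shows "pos_upto m (\<Sum>s=1..m. smult (1 / real s) (fps_nth ((1 - mixed_series) ^ s) m))"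
proof -
  let ?Z = "1 - mixed_series"
  have st: "smult (real m) (smult (1 / real s) (fps_nth (?Z ^ s) m)) =
      fps_nth (?Z ^ (s - 1) * (- fps_deriv mixed_series)) (m - 1)" if "s \<in> {1..m}" for s
  proof -
    have "of_nat m * fps_nth (?Z ^ s) m = fps_nth (fps_deriv (?Z ^ s)) (m - 1)"
      using assms by (simp add: mult.commute)
    also have "fps_deriv (?Z ^ s) = fps_const (of_nat s) * (- fps_deriv mixed_series) * ?Z ^ (s - 1)"
      by (simp add: fps_deriv_power)
    also have "fps_nth \<dots> (m - 1) = of_nat s * fps_nth (?Z ^ (s - 1) * (- fps_deriv mixed_series)) (m - 1)"
      by (simp only: mult.assoc fps_mult_left_const_nth mult.commute)
    finally have "smult (real m) (fps_nth (?Z ^ s) m) =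
        smult (real s) (fps_nth (?Z ^ (s - 1) * (- fps_deriv mixed_series)) (m - 1))"
      by (simp only: of_nat_poly) simp
    then have "smult (1 / real s) (smult (real m) (fps_nth (?Z ^ s) m)) =
        smult (1 / real s) (smult (real s) (fps_nth (?Z ^ (s - 1) * (- fps_deriv mixed_series)) (m - 1)))"
      by (simp only:)
    then show ?thesis
      using that by (simp add: mult.commute)
  qed
  have "smult (real m) (\<Sum>s=1..m. smult (1 / real s) (fps_nth (?Z ^ s) m)) =
      (\<Sum>s=1..m. fps_nth (?Z ^ (s - 1) * (- fps_deriv mixed_series)) (m - 1))"
    unfolding smult_sum_right by (intro sum.cong refl st)
  also have "\<dots> = (\<Sum>s<m. fps_nth (?Z ^ s * (- fps_deriv mixed_series)) (m - 1))"
    by (rule sum.reindex_bij_witness[of _ Suc "\<lambda>s. s - 1"]) auto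
  also have "\<dots> = fps_nth ((\<Sum>s<m. ?Z ^ s) * (- fps_deriv mixed_series)) (m - 1)"
    by (simp add: sum_distrib_right fps_sum_nth sum_negf)
  finally have "pos_upto m (smult (real m) (\<Sum>s=1..m. smult (1 / real s) (fps_nth (?Z ^ s) m)))"
    using log_deriv_pos[of "m - 1" m] assms by simp
  then show ?thesis
    using assms by (simp add: pos_upto_def zero_le_mult_iff zero_less_mult_iff)
qed

text \<open>The coefficient of the power sum in a symmetrized monomial with s variables, modulo products.\<close>

definition power_sum_weight :: "nat \<Rightarrow> nat \<Rightarrow> real"
  where "power_sum_weight n s = (-1) ^ (s - 1) * fact (s - 1) * fact (n - s)"

text \<open>The series cosh z + u sinh z / z in y = z^2.\<close>

definition face_series :: "real poly fps"
  where "face_series = Abs_fps (\<lambda>j. [:1 / fact (2 * j), 1 / fact (2 * j + 1):])"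

text \<open>Substituting -(1 + u)y for y, that is iz for z together with the rescaling, carries Y =
  \<open>face_series\<close> - (1 + u) to -(1 + u)(1 - \<open>mixed_series\<close>). In the
  coefficients of the s-th powers a factor (1 + u)^s cancels, and s \<le> m leaves the exponent m -
  s.\<close>

lemma face_series_power_nth:
  assumes "s \<le> m"
  shows "one_u ^ (m - s) * fps_nth ((face_series - fps_const one_u) ^ s) m =
    (-1) ^ (s + m) * fps_nth ((1 - mixed_series) ^ s) m"
proof -
  let ?Y = "face_series - fps_const one_u"
  let ?c = "fps_const (- one_u) * fps_X"
  have "fps_const one_u * (1 - mixed_series) = - fps_compose ?Y ?c"
    unfolding fps_compose_linear
  proof (rule fps_ext)
    fix j show "fps_nth (fps_const one_u * (1 - mixed_series)) j =
      fps_nth (- Abs_fps (\<lambda>n. (- one_u) ^ n * fps_nth ?Y n)) j"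
      proof (cases "j = 0")
      case True
      then show ?thesis
        by (simp add: mixed_series_def face_series_def one_u_def)
    next
      case False
      then have "fps_nth (fps_const one_u * (1 - mixed_series)) j = - (one_u * fps_nth mixed_series j)"
        by simp
      moreover have "fps_nth ?Y j = [:1 / fact (2 * j), 1 / fact (2 * j + 1):]"
        using False by (simp add: face_series_def del: fact_Suc)
      ultimately have "fps_nth (fps_const one_u * (1 - mixed_series)) j = - ((- one_u) ^ j * fps_nth ?Y j)"
        using False unfolding power_minus[of one_u]
        by (simp only: mixed_series_nth_pos neq0_conv mult.assoc)
      then show ?thesis
        by simp
    qed
  qed
  then have "(fps_const one_u * (1 - mixed_series)) ^ s = (-1) ^ s * fps_compose (?Y ^ s) ?c"
    by (simp add: fps_compose_power power_minus[of "fps_compose ?Y ?c"])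
  then have "fps_nth ((fps_const one_u * (1 - mixed_series)) ^ s) m =
      fps_nth ((-1) ^ s * fps_compose (?Y ^ s) ?c) m"
    by (simp only:)
  also have "fps_nth ((-1) ^ s * fps_compose (?Y ^ s) ?c) m = (-1) ^ s * fps_nth (fps_compose (?Y ^ s) ?c) m"
    by (cases "even s") auto
  also have "\<dots> = (-1) ^ (s + m) * (one_u ^ m * fps_nth (?Y ^ s) m)"
    unfolding fps_compose_linear by (simp add: power_minus[of "one_u"] power_add mult_ac)
  finally have "one_u ^ s * fps_nth ((1 - mixed_series) ^ s) m =
      (-1) ^ (s + m) * (one_u ^ m * fps_nth (?Y ^ s) m)"
    by (simp add: power_mult_distrib fps_const_power[symmetric] del: fps_const_power)
       (simp add: fps_const_power)
  also have "one_u ^ m = one_u ^ s * one_u ^ (m - s)"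
    using assms by (simp add: power_add[symmetric])
  finally have "one_u ^ s * fps_nth ((1 - mixed_series) ^ s) m =
      one_u ^ s * ((-1) ^ (s + m) * (one_u ^ (m - s) * fps_nth (?Y ^ s) m))"
    by (simp add: mult_ac)
  then have "fps_nth ((1 - mixed_series) ^ s) m = (-1) ^ (s + m) * (one_u ^ (m - s) * fps_nth (?Y ^ s) m)"
    by simp
  then show ?thesis
    by (cases "even (s + m)") auto
qed

text \<open>Terms with s = 0 or s > m vanish since Y has no constant term, and m \<le> n ensures
  that the range of s contains all of 1, ..., m. What remains is, up to a nonzero constant, (1 +
  u)^(n-m) times the sum in \<open>log_series_pos\<close>.\<close>

lemma face_coefficient_nonzero:
  assumes "1 \<le> m" "m \<le> n" "k \<le> n"
  shows "coeff (\<Sum>s=0..n. of_nat (n choose s) * ([:power_sum_weight n s:] *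
    (one_u ^ (n - s) * fps_nth ((face_series - fps_const one_u) ^ s) m))) k \<noteq> 0"
proof -
  let ?Y = "face_series - fps_const one_u"
  let ?t = "\<lambda>s. of_nat (n choose s) * ([:power_sum_weight n s:] * (one_u ^ (n - s) * fps_nth (?Y ^ s) m))"
  have Y0: "fps_nth ?Y 0 = 0"
    by (simp add: face_series_def one_u_def)
  have "(\<Sum>s=0..n. ?t s) = (\<Sum>s=1..m. ?t s)"
  proof (rule sum.mono_neutral_right)
    show "\<forall>s\<in>{0..n} - {1..m}. ?t s = 0"
    proof
      fix s assume "s \<in> {0..n} - {1..m}"
      then have "fps_nth (?Y ^ s) m = 0"
        using startsby_zero_power_prefix[OF Y0, of s] assms by (cases "s = 0") auto
      then show "?t s = 0"
        by simp
    qed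
  qed (use assms in auto)
  also have "\<dots> = (\<Sum>s=1..m. smult ((-1) ^ (m - 1) * fact n)
      (one_u ^ (n - m) * smult (1 / real s) (fps_nth ((1 - mixed_series) ^ s) m)))"
  proof (intro sum.cong refl)
    fix s assume s: "s \<in> {1..m}"
    have "n - s = (n - m) + (m - s)"
      using s assms by simp
    then have "one_u ^ (n - s) * fps_nth (?Y ^ s) m = one_u ^ (n - m) * (one_u ^ (m - s) * fps_nth (?Y ^ s) m)"
      by (simp only: power_add mult.assoc)
    also have "\<dots> = one_u ^ (n - m) * ((-1) ^ (s + m) * fps_nth ((1 - mixed_series) ^ s) m)"
      using s by (subst face_series_power_nth) auto
    also have "\<dots> = smult ((-1) ^ (s + m)) (one_u ^ (n - m) * fps_nth ((1 - mixed_series) ^ s) m)"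
      by (cases "even (s + m)") auto
    finally have "?t s = smult (real (n choose s) * power_sum_weight n s * (-1) ^ (s + m))
        (one_u ^ (n - m) * fps_nth ((1 - mixed_series) ^ s) m)"
      by (simp only: of_nat_poly) (simp add: mult_ac)
    also have "real (n choose s) * power_sum_weight n s * (-1) ^ (s + m) = (-1) ^ (m - 1) * fact n * (1 / real s)"
    proof -
      have "(fact s :: real) = real s * fact (s - 1)"
        using s by (metis atLeastAtMost_iff fact_num_eq_if not_one_le_zero)
      then have b: "real (n choose s) * fact (s - 1) * fact (n - s) = fact n / real s"
        using s assms by (subst binomial_fact) (auto simp: field_simps)
      \<comment> \<open>The sign of the weight and the sign caused by z -> iz combine to one that
        does not depend on s, so it can be pulled out of the sum.\<close>
      have e: "(-1) ^ (s - 1) * (-1) ^ (s + m) = ((-1) ^ (m - 1) :: real)"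
        using s assms by (auto simp: minus_one_power_iff)
      have "real (n choose s) * power_sum_weight n s * (-1) ^ (s + m) =
          ((-1) ^ (s - 1) * (-1) ^ (s + m)) * (real (n choose s) * fact (s - 1) * fact (n - s))"
        by (simp add: power_sum_weight_def mult_ac)
      then show ?thesis
        unfolding b e by simp
    qed
    finally show "?t s = smult ((-1) ^ (m - 1) * fact n)
      (one_u ^ (n - m) * smult (1 / real s) (fps_nth ((1 - mixed_series) ^ s) m))"
      by simp
  qed
  also have "\<dots> = smult ((-1) ^ (m - 1) * fact n) (one_u ^ (n - m) *
      (\<Sum>s=1..m. smult (1 / real s) (fps_nth ((1 - mixed_series) ^ s) m)))"
    by (simp add: smult_sum_right sum_distrib_left)
  \<comment> \<open>The factor (1 + u)^(n-m) widens the strictly positive range from exponents up to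
    m to exponents up to n, and k lies in it.\<close>
  finally show ?thesis
    using pos_upto_one_u_power[OF log_series_pos[OF assms(1)], of "n - m"] assms
    by (auto simp: pos_upto_def)
qed

section \<open>Evaluation of polynomials\<close>

definition mon_eval :: "(nat \<Rightarrow> 'b :: comm_ring_1) \<Rightarrow> (nat \<Rightarrow>\<^sub>0 nat) \<Rightarrow> 'b"
  where "mon_eval x m = (\<Prod>i\<in>Poly_Mapping.keys m. x i ^ Poly_Mapping.lookup m i)"

lemma mon_eval_superset:
  assumes "finite S" "Poly_Mapping.keys m \<subseteq> S"
  shows "mon_eval x m = (\<Prod>i\<in>S. x i ^ Poly_Mapping.lookup m i)"
  unfolding mon_eval_def using assms
  by (intro prod.mono_neutral_left) (auto simp: in_keys_iff)

lemma mon_eval_0 [simp]: "mon_eval x 0 = 1"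
  by (simp add: mon_eval_def)

lemma mon_eval_single [simp]: "mon_eval x (Poly_Mapping.single i d) = x i ^ d"
  by (cases "d = 0") (simp_all add: mon_eval_def)

lemma mon_eval_add: "mon_eval x (m + m') = mon_eval x m * mon_eval x m'"
proof -
  let ?S = "Poly_Mapping.keys m \<union> Poly_Mapping.keys m'"
  have "Poly_Mapping.keys (m + m') \<subseteq> ?S"
    by (rule keys_add)
  then show ?thesis
    by (simp add: mon_eval_superset[of ?S] lookup_add power_add prod.distrib)
qed

lemma rpoly_sum_monomials:
  fixes p :: rpoly
  shows "p = (\<Sum>m\<in>Poly_Mapping.keys p. Poly_Mapping.single m (Poly_Mapping.lookup p m))"
proof (rule poly_mapping_eqI)
  fix k
  have "Poly_Mapping.lookup (\<Sum>m\<in>Poly_Mapping.keys p. Poly_Mapping.single m (Poly_Mapping.lookup p m)) k =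
      (\<Sum>m\<in>Poly_Mapping.keys p. if m = k then Poly_Mapping.lookup p m else 0)"
    unfolding lookup_sum by (intro sum.cong refl) (simp add: lookup_single when_def)
  then show "Poly_Mapping.lookup p k =
    Poly_Mapping.lookup (\<Sum>m\<in>Poly_Mapping.keys p. Poly_Mapping.single m (Poly_Mapping.lookup p m)) k"
    by (simp add: sum.delta in_keys_iff)
qed

text \<open>One evaluation serves three targets: the reals for testing identities, the complex
  numbers for solving equations, and \<open>rpoly\<close> itself, via \<open>Const\<close>, for
  substitution.\<close>

locale coeff_hom =
  fixes c :: "real \<Rightarrow> 'b :: comm_ring_1"
  assumes hom_add: "c (a + b) = c a + c b"
    and hom_mult: "c (a * b) = c a * c b"
    and hom_one: "c 1 = 1"
begin

definition ev :: "(nat \<Rightarrow> 'b) \<Rightarrow> rpoly \<Rightarrow> 'b"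
  where "ev x p = (\<Sum>m\<in>Poly_Mapping.keys p. c (Poly_Mapping.lookup p m) * mon_eval x m)"

lemma hom_zero: "c 0 = 0"
  using hom_add[of 0 0] by simp

lemma ev_superset:
  assumes "finite K" "Poly_Mapping.keys p \<subseteq> K"
  shows "ev x p = (\<Sum>m\<in>K. c (Poly_Mapping.lookup p m) * mon_eval x m)"
  unfolding ev_def using assms
  by (intro sum.mono_neutral_left) (auto simp: in_keys_iff hom_zero)

lemma ev_0 [simp]: "ev x 0 = 0"
  by (simp add: ev_def)

lemma ev_add: "ev x (p + q) = ev x p + ev x q"
proof -
  let ?K = "Poly_Mapping.keys p \<union> Poly_Mapping.keys q"
  have "Poly_Mapping.keys (p + q) \<subseteq> ?K"
    by (rule keys_add)
  then show ?thesis
    by (simp add: ev_superset[of ?K] lookup_add hom_add distrib_right sum.distrib)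
qed

lemma ev_sum: "ev x (\<Sum>i\<in>A. f i) = (\<Sum>i\<in>A. ev x (f i))"
  by (induction A rule: infinite_finite_induct) (simp_all add: ev_add)

lemma ev_single: "ev x (Poly_Mapping.single m a) = c a * mon_eval x m"
  by (cases "a = 0") (simp_all add: ev_def hom_zero)

lemma ev_mult: "ev x (p * q) = ev x p * ev x q"
proof -
  let ?s = "\<lambda>p m. Poly_Mapping.single m (Poly_Mapping.lookup p m) :: rpoly"
  have "p * q = (\<Sum>m\<in>Poly_Mapping.keys p. ?s p m) * (\<Sum>m\<in>Poly_Mapping.keys q. ?s q m)"
    by (simp flip: rpoly_sum_monomials)
  also have "\<dots> = (\<Sum>m\<in>Poly_Mapping.keys p. \<Sum>m'\<in>Poly_Mapping.keys q. ?s p m * ?s q m')"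
    by (rule sum_product)
  finally have "ev x (p * q) = (\<Sum>m\<in>Poly_Mapping.keys p. \<Sum>m'\<in>Poly_Mapping.keys q.
      (c (Poly_Mapping.lookup p m) * mon_eval x m) * (c (Poly_Mapping.lookup q m') * mon_eval x m'))"
    by (simp add: ev_sum mult_single ev_single hom_mult mon_eval_add mult_ac)
  then show ?thesis
    by (simp add: ev_def sum_product)
qed

lemma ev_Const [simp]: "ev x (Const a) = c a"
  by (simp add: Const_def ev_single)

lemma ev_Var [simp]: "ev x (Var i) = x i"
  by (simp add: Var_def ev_single hom_one)

lemma ev_1 [simp]: "ev x 1 = 1"
  using ev_Const[of x 1] by (simp add: Const_def hom_one)

lemma ev_uminus: "ev x (- p) = - ev x p"
  using ev_add[of x p "- p"] by (simp add: eq_neg_iff_add_eq_0 add.commute)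

lemma ev_diff: "ev x (p - q) = ev x p - ev x q"
  using ev_add[of x p "- q"] by (simp add: ev_uminus)

lemma ev_prod: "ev x (\<Prod>i\<in>A. f i) = (\<Prod>i\<in>A. ev x (f i))"
  by (induction A rule: infinite_finite_induct) (simp_all add: ev_mult)

lemma ev_power: "ev x (p ^ k) = ev x p ^ k"
  by (induction k) (simp_all add: ev_mult)

lemma ev_of_nat: "ev x (of_nat k) = of_nat k"
  by (induction k) (simp_all add: ev_add)

lemma ev_of_int: "ev x (of_int k) = of_int k"
  by (cases k) (simp_all add: ev_of_nat ev_uminus ev_diff)

lemma ev_mon_eval: "ev x (mon_eval f m) = mon_eval (\<lambda>i. ev x (f i)) m"
  by (simp add: mon_eval_def ev_prod ev_power)

lemma ev_subst: "ev x (subst f p) = ev (\<lambda>i. ev x (f i)) p"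
  unfolding subst_def mon_eval_def[symmetric]
  by (simp add: ev_sum ev_mult ev_mon_eval) (simp add: ev_def)

lemma ev_cong:
  assumes "\<And>i. i \<in> vars p \<Longrightarrow> x i = y i"
  shows "ev x p = ev y p"
  unfolding ev_def mon_eval_def
  by (intro sum.cong prod.cong refl arg_cong2[where f = "(*)"] arg_cong2[where f = "(^)"] assms)
     (auto simp: vars_def)

lemma ev_W_act: "ev x (W_act \<sigma> Var i) = W_act \<sigma> x i"
  by (simp add: W_act_def ev_mult ev_of_int)

lemma ev_W_pullback: "ev x (W_pullback \<sigma> p) = ev (W_act \<sigma> x) p"
  unfolding W_pullback_def ev_subst by (simp add: ev_W_act)

lemma ev_H_poly: "ev x (H_poly j m t) = H_poly j m (\<lambda>i. ev x (t i))"
  by (simp add: H_poly_def ev_sum ev_prod ev_power)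

lemma ev_h_poly: "ev x (h_poly n k m) = H_poly (k + 1) m (\<lambda>i. \<Sum>l=i..n. x l)"
  by (simp add: h_poly_def ev_H_poly ev_sum)

end

lemma Const_add: "Const (a + b) = Const a + Const b"
  by (simp add: Const_def single_add)

lemma Const_mult: "Const (a * b) = Const a * Const b"
  by (simp add: Const_def mult_single)

lemma Const_0 [simp]: "Const 0 = 0"
  by (simp add: Const_def)

lemma Const_1 [simp]: "Const 1 = 1"
  by (simp add: Const_def)

lemma Const_uminus: "Const (- a) = - Const a"
  by (simp add: Const_def single_uminus)

lemma Const_of_nat: "Const (of_nat k) = of_nat k"
  by (simp add: Const_def)

lemma Const_fact: "Const (fact k) = fact k"
  using Const_of_nat[of "fact k"] by simp

lemma Const_sum: "Const (\<Sum>i\<in>A. f i) = (\<Sum>i\<in>A. Const (f i))"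
  by (induction A rule: infinite_finite_induct) (simp_all add: Const_add)

interpretation real_ev: coeff_hom "\<lambda>a :: real. a"
  by unfold_locales simp_all

interpretation complex_ev: coeff_hom complex_of_real
  by unfold_locales simp_all

interpretation poly_ev: coeff_hom Const
  by unfold_locales (simp_all add: Const_add Const_mult)

lemma subst_eq_ev: "subst f p = poly_ev.ev f p"
  unfolding subst_def poly_ev.ev_def mon_eval_def ..

lemma complex_ev_of_real: "complex_ev.ev (\<lambda>i. of_real (x i)) p = of_real (real_ev.ev x p)"
  by (simp add: complex_ev.ev_def real_ev.ev_def mon_eval_def)

text \<open>Such points have no vanishing signed sum over a nonempty finite set of indices, so the
  division by partial sums is legitimate on their whole group orbit. There are still enough of them
  to detect a nonzero polynomial.\<close>

definition superincreasing :: "(nat \<Rightarrow> real) \<Rightarrow> bool"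
  where "superincreasing x \<longleftrightarrow> (\<forall>i. sum x {..<i} < x i)"

lemma superincreasing_pos:
  assumes "superincreasing x"
  shows "x i > 0"
proof (induction i rule: less_induct)
  case (less i)
  then have "sum x {..<i} \<ge> 0"
    by (intro sum_nonneg) (auto intro: less_imp_le)
  then show ?case
    using assms by (metis superincreasing_def le_less_trans)
qed

text \<open>The term of largest index exceeds the sum of the absolute values of all others, whatever
  the signs.\<close>

lemma superincreasing_signed_sum_nonzero:
  assumes x: "superincreasing x" and S: "finite S" "S \<noteq> {}"
    and e: "\<And>i. i \<in> S \<Longrightarrow> \<bar>e i\<bar> = 1"
  shows "(\<Sum>i\<in>S. e i * x i) \<noteq> 0"
proof
  assume z: "(\<Sum>i\<in>S. e i * x i) = 0"
  let ?M = "Max S"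
  have M: "?M \<in> S"
    using S by simp
  have "e ?M * x ?M = - (\<Sum>i\<in>S - {?M}. e i * x i)"
    using z sum.remove[OF S(1) M, of "\<lambda>i. e i * x i"] by simp
  then have "\<bar>e ?M * x ?M\<bar> = \<bar>\<Sum>i\<in>S - {?M}. e i * x i\<bar>"
    by simp
  also have "\<dots> \<le> (\<Sum>i\<in>S - {?M}. \<bar>e i * x i\<bar>)"
    by (rule sum_abs)
  also have "\<dots> = (\<Sum>i\<in>S - {?M}. x i)"
    using e superincreasing_pos[OF x] by (intro sum.cong refl) (simp add: abs_mult less_imp_le)
  also have "\<dots> \<le> sum x {..<?M}"
  proof (rule sum_mono2)
    show "S - {?M} \<subseteq> {..<?M}"
      using S Max_ge[OF S(1)] by (auto simp: order.strict_iff_order)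
  qed (use superincreasing_pos[OF x] in \<open>auto intro: less_imp_le\<close>)
  also have "\<dots> < x ?M"
    using x by (simp add: superincreasing_def)
  finally show False
    using e[OF M] superincreasing_pos[OF x, of ?M] by (simp add: abs_mult)
qed

text \<open>Makes the points of a Kronecker substitution admissible: the sum up to index i is below
  2t^(N^i) \<le> t^(N^i + 1) \<le> t^(N^(i+1)).\<close>

lemma superincreasing_tower:
  assumes "t \<ge> 2" "N \<ge> 2"
  shows "superincreasing (\<lambda>i. t ^ (N ^ i))"
  unfolding superincreasing_def
proof
  fix i show "(\<Sum>i<i. t ^ N ^ i) < t ^ N ^ i"
  proof (induction i)
    case (Suc i)
    have "(\<Sum>i<Suc i. t ^ N ^ i) < 2 * t ^ N ^ i"
      using Suc.IH by simp
    also have "\<dots> \<le> t ^ (N ^ i + 1)"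
      using assms by simp
    also have "\<dots> \<le> t ^ (N ^ Suc i)"
    proof (rule power_increasing)
      have "N ^ i + 1 \<le> N ^ i + N ^ i"
        using assms by simp
      also have "\<dots> = 2 * N ^ i"
        by simp
      also have "\<dots> \<le> N * N ^ i"
        using assms by (intro mult_right_mono) auto
      finally show "N ^ i + 1 \<le> N ^ Suc i"
        by simp
    qed (use assms in auto)
    finally show ?case .
  qed (use assms in auto)
qed

lemma digits_unique:
  fixes a b :: "nat \<Rightarrow> nat"
  assumes "\<And>i. i < L \<Longrightarrow> a i < N" "\<And>i. i < L \<Longrightarrow> b i < N"
    and "(\<Sum>i<L. a i * N ^ i) = (\<Sum>i<L. b i * N ^ i)" and "i < L"
  shows "a i = b i"
  using assms
proof (induction L arbitrary: a b i)
  case (Suc L)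
  have s: "(\<Sum>i<Suc L. f i * N ^ i) = f 0 + N * (\<Sum>i<L. f (Suc i) * N ^ i)" for f :: "nat \<Rightarrow> nat"
    by (simp add: sum.lessThan_Suc_shift sum_distrib_left mult_ac del: sum.lessThan_Suc)
  have eq: "a 0 + N * (\<Sum>i<L. a (Suc i) * N ^ i) = b 0 + N * (\<Sum>i<L. b (Suc i) * N ^ i)"
    using Suc.prems(3) unfolding s .
  have lt: "a 0 < N" "b 0 < N"
    using Suc.prems(1,2) by auto
  have z: "a 0 = b 0"
    using arg_cong[OF eq, of "\<lambda>u. u mod N"] lt by simp
  have "(\<Sum>i<L. a (Suc i) * N ^ i) = (\<Sum>i<L. b (Suc i) * N ^ i)"
    using eq z lt by simp
  then have "a (Suc j) = b (Suc j)" if "j < L" for j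
    using Suc.IH[of "\<lambda>i. a (Suc i)" "\<lambda>i. b (Suc i)" j] Suc.prems(1,2) that by auto
  then show ?case
    using z Suc.prems(4) by (cases i) auto
qed simp

text \<open>Kronecker substitution x_i = t^(N^i) turns p into a univariate polynomial with the same coefficients.\<close>

lemma rpoly_zeroI:
  assumes "\<And>x. superincreasing x \<Longrightarrow> real_ev.ev x p = 0"
  shows "p = 0"
proof (rule ccontr)
  assume "p \<noteq> 0"
  then obtain m0 where m0: "m0 \<in> Poly_Mapping.keys p"
    by (metis keys_eq_empty ex_in_conv)
  let ?K = "Poly_Mapping.keys p"
  have finV: "finite (\<Union>m\<in>?K. Poly_Mapping.keys m)"
    by simp
  then obtain L where L: "\<And>m i. m \<in> ?K \<Longrightarrow> i \<in> Poly_Mapping.keys m \<Longrightarrow> i < L"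
    by (meson finite_nat_set_iff_bounded UN_I)
  have "finite (\<Union>m\<in>?K. Poly_Mapping.lookup m ` {..<L})"
    by simp
  then obtain N0 where N0: "\<And>m i. m \<in> ?K \<Longrightarrow> i < L \<Longrightarrow> Poly_Mapping.lookup m i < N0"
    unfolding finite_nat_set_iff_bounded by blast
  \<comment> \<open>Larger than every exponent, so that exponent vectors are strings of base N
    digits, and at least 2 as \<open>superincreasing_tower\<close> demands.\<close>
  define N where "N = N0 + 2"
  have N: "N \<ge> 2"
    by (simp add: N_def)
  have bd: "Poly_Mapping.lookup m i < N" if "m \<in> ?K" "i < L" for m i
    using N0[OF that] by (simp add: N_def)
  define e where "e = (\<lambda>m. \<Sum>i<L. Poly_Mapping.lookup m i * N ^ i)"
  define P where "P = (\<Sum>m\<in>?K. monom (Poly_Mapping.lookup p m) (e m))"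
  have inj: "m = m'" if "m \<in> ?K" "m' \<in> ?K" "e m = e m'" for m m'
  proof (rule poly_mapping_eqI)
    fix i
    show "Poly_Mapping.lookup m i = Poly_Mapping.lookup m' i"
    proof (cases "i < L")
      case True
      show ?thesis
        by (rule digits_unique[of L _ N]) (use that True bd in \<open>auto simp: e_def\<close>)
    next
      case False
      then show ?thesis
        using L that by (metis in_keys_iff)
    qed
  qed
  \<comment> \<open>Every t \<ge> 2 gives an admissible point, so the univariate polynomial has
    infinitely many roots.\<close>
  have "poly P t = 0" if "t \<ge> 2" for t
  proof -
    have "mon_eval (\<lambda>i. t ^ N ^ i) m = t ^ e m" if "m \<in> ?K" for m
    proof -
      have "mon_eval (\<lambda>i. t ^ N ^ i) m = (\<Prod>i<L. (t ^ N ^ i) ^ Poly_Mapping.lookup m i)"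
        using L[OF that] by (intro mon_eval_superset) auto
      then show ?thesis
        by (simp add: e_def power_sum power_mult[symmetric] mult.commute)
    qed
    then have "poly P t = real_ev.ev (\<lambda>i. t ^ N ^ i) p"
      by (simp add: P_def poly_sum poly_monom real_ev.ev_def)
    then show ?thesis
      using assms superincreasing_tower[OF that N] by simp
  qed
  then have "{2..} \<subseteq> {t. poly P t = 0}"
    by auto
  then have "infinite {t. poly P t = 0}"
    using infinite_Ici infinite_super by blast
  then have "P = 0"
    using poly_roots_finite by blast
  then have "0 = coeff P (e m0)"
    by simp
  also have "\<dots> = (\<Sum>m\<in>?K. if m = m0 then Poly_Mapping.lookup p m else 0)"
    unfolding P_def coeff_sum coeff_monom using inj m0 by (intro sum.cong refl) auto
  finally show False
    using m0 by (simp add: in_keys_iff)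
qed

lemma rpoly_eqI:
  assumes "\<And>x. superincreasing x \<Longrightarrow> real_ev.ev x p = real_ev.ev x q"
  shows "p = q"
  using rpoly_zeroI[of "p - q"] assms by (simp add: real_ev.ev_diff)

section \<open>Variables and generated subalgebras\<close>

lemma vars_Const [simp]: "vars (Const a) = {}"
  by (cases "a = 0") (simp_all add: vars_def Const_def)

lemma vars_Var [simp]: "vars (Var i) = {i}"
  by (simp add: vars_def Var_def)

lemma vars_add: "vars (p + q) \<subseteq> vars p \<union> vars q"
  using keys_add[of p q] by (auto simp: vars_def)

lemma vars_mult: "vars (p * q) \<subseteq> vars p \<union> vars q"
proof
  fix i assume "i \<in> vars (p * q)"
  then obtain m where "m \<in> Poly_Mapping.keys (p * q)" and i: "i \<in> Poly_Mapping.keys m"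
    by (auto simp: vars_def)
  then obtain a b where "m = a + b" "a \<in> Poly_Mapping.keys p" "b \<in> Poly_Mapping.keys q"
    using keys_mult[of p q] by blast
  moreover have "i \<in> Poly_Mapping.keys a \<or> i \<in> Poly_Mapping.keys b"
    using i keys_add[of a b] calculation(1) by auto
  ultimately show "i \<in> vars p \<union> vars q"
    by (auto simp: vars_def)
qed

lemma generated_algebra_mono:
  assumes "S \<subseteq> generated_algebra T"
  shows "generated_algebra S \<subseteq> generated_algebra T"
proof
  fix p assume "p \<in> generated_algebra S"
  then show "p \<in> generated_algebra T"
    using assms by induction (auto intro: generated_algebra.intros)
qed

lemma generated_algebra_subset: "S \<subseteq> T \<Longrightarrow> generated_algebra S \<subseteq> generated_algebra T"
  by (rule generated_algebra_mono) (auto intro: generated_algebra.gen)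

lemma generated_algebra_uminus: "p \<in> generated_algebra S \<Longrightarrow> - p \<in> generated_algebra S"
  using generated_algebra.mult[OF generated_algebra.Const[of "-1"]] by (simp add: Const_uminus)

lemma generated_algebra_diff:
  "p \<in> generated_algebra S \<Longrightarrow> q \<in> generated_algebra S \<Longrightarrow> p - q \<in> generated_algebra S"
  using generated_algebra.add[OF _ generated_algebra_uminus] by fastforce

lemma generated_algebra_sum:
  "(\<And>i. i \<in> A \<Longrightarrow> f i \<in> generated_algebra S) \<Longrightarrow> (\<Sum>i\<in>A. f i) \<in> generated_algebra S"
  using generated_algebra.Const[of 0 S]
  by (induction A rule: infinite_finite_induct) (auto intro: generated_algebra.add)

text \<open>Membership becomes an explicit polynomial in the generators, with variables indexed as
  they are, which can be evaluated at prescribed values of the generators.\<close>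

lemma generated_algebra_eq_subst:
  assumes "p \<in> generated_algebra (f ` I)"
  shows "\<exists>q. vars q \<subseteq> I \<and> p = subst f q"
  using assms
proof induction
  case (Const c)
  then show ?case
    by (intro exI[of _ "Const c"]) (simp add: subst_eq_ev)
next
  case (gen p)
  then obtain i where "i \<in> I" "p = f i"
    by auto
  then show ?case
    by (intro exI[of _ "Var i"]) (simp add: subst_eq_ev)
next
  case (add p q)
  then obtain p' q' where "vars p' \<subseteq> I" "p = subst f p'" "vars q' \<subseteq> I" "q = subst f q'"
    by auto
  then show ?case
    using vars_add[of p' q'] by (intro exI[of _ "p' + q'"]) (auto simp: subst_eq_ev poly_ev.ev_add)
next
  case (mult p q)
  then obtain p' q' where "vars p' \<subseteq> I" "p = subst f p'" "vars q' \<subseteq> I" "q = subst f q'"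
    by auto
  then show ?case
    using vars_mult[of p' q'] by (intro exI[of _ "p' * q'"]) (auto simp: subst_eq_ev poly_ev.ev_mult)
qed

lemma W_pullback_eq_ev: "W_pullback \<sigma> p = poly_ev.ev (W_act \<sigma> Var) p"
  by (simp add: W_pullback_def subst_eq_ev)

lemma generated_algebra_subset_invariants:
  assumes "S \<subseteq> W_invariants n"
  shows "generated_algebra S \<subseteq> W_invariants n"
proof
  fix p assume "p \<in> generated_algebra S"
  then show "p \<in> W_invariants n"
  proof induction
    case (add p q)
    then show ?case
      using vars_add[of p q]
      by (auto simp: W_invariants_def poly_ring_def W_pullback_eq_ev poly_ev.ev_add)
  next
    case (mult p q)
    then show ?case
      using vars_mult[of p q]
      by (auto simp: W_invariants_def poly_ring_def W_pullback_eq_ev poly_ev.ev_mult)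
  qed (use assms in \<open>auto simp: W_invariants_def poly_ring_def W_pullback_eq_ev\<close>)
qed

section \<open>Symmetrized monomials and power sums\<close>

text \<open>All n! permutations are summed without removing repetitions, so that one formula serves
  every exponent vector; the repetitions reappear as factorials in the weights. The target ring is
  general because both polynomials and numbers are inserted.\<close>

definition mono_sym :: "nat \<Rightarrow> (nat \<Rightarrow> nat) \<Rightarrow> (nat \<Rightarrow> 'a :: comm_ring_1) \<Rightarrow> 'a"
  where "mono_sym n b y = (\<Sum>\<pi> | \<pi> permutes {1..n}. \<Prod>i=1..n. y (\<pi> i) ^ b i)"

definition power_sum :: "nat \<Rightarrow> nat \<Rightarrow> (nat \<Rightarrow> 'a :: comm_ring_1) \<Rightarrow> 'a"
  where "power_sum n r y = (\<Sum>i=1..n. y i ^ r)"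

definition elem_sym :: "nat \<Rightarrow> nat \<Rightarrow> (nat \<Rightarrow> 'a :: comm_ring_1) \<Rightarrow> 'a"
  where "elem_sym n i y = (\<Sum>S | S \<subseteq> {1..n} \<and> card S = i. \<Prod>j\<in>S. y j)"

abbreviation supp :: "nat \<Rightarrow> (nat \<Rightarrow> nat) \<Rightarrow> nat set"
  where "supp n b \<equiv> {i \<in> {1..n}. b i \<noteq> 0}"

lemma mono_sym_cong: "(\<And>i. i \<in> {1..n} \<Longrightarrow> b i = b' i) \<Longrightarrow> mono_sym n b y = mono_sym n b' y"
  unfolding mono_sym_def by (intro sum.cong prod.cong refl) auto

lemma mono_sym_compose:
  assumes "\<tau> permutes {1..n}"
  shows "mono_sym n (\<lambda>i. b (\<tau> i)) y = mono_sym n b y"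
proof -
  have "mono_sym n b y = (\<Sum>\<pi> | \<pi> permutes {1..n}. \<Prod>i=1..n. y ((\<pi> \<circ> inv \<tau>) i) ^ b i)"
    unfolding mono_sym_def
    by (rule sum.reindex_bij_witness[of _ "\<lambda>\<pi>. \<pi> \<circ> inv \<tau>" "\<lambda>\<pi>. \<pi> \<circ> \<tau>"])
       (use assms in \<open>auto simp: permutes_compose permutes_inv comp_assoc permutes_inv_o\<close>)
  also have "\<dots> = (\<Sum>\<pi> | \<pi> permutes {1..n}. \<Prod>i=1..n. y (\<pi> i) ^ b (\<tau> i))"
  proof (intro sum.cong refl)
    fix \<pi>
    show "(\<Prod>i=1..n. y ((\<pi> \<circ> inv \<tau>) i) ^ b i) = (\<Prod>i=1..n. y (\<pi> i) ^ b (\<tau> i))"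
      using prod.permute[OF assms, of "\<lambda>i. y ((\<pi> \<circ> inv \<tau>) i) ^ b i"] permutes_inverses[OF assms]
      by (simp add: comp_def)
  qed
  finally show ?thesis
    by (simp add: mono_sym_def)
qed

lemma mono_sym_zero: "mono_sym n (\<lambda>_. 0) y = fact n"
proof -
  have "card {\<pi>. \<pi> permutes {1..n}} = fact n"
    by (rule card_permutations) auto
  then show ?thesis
    by (simp add: mono_sym_def)
qed

text \<open>For each permutation \<pi> the power sum is also the sum of the y(\<pi> j)^r, and each
  summand raises a single exponent.\<close>

lemma power_sum_mult_mono_sym:
  "power_sum n r y * mono_sym n b y = (\<Sum>j=1..n. mono_sym n (b(j := b j + r)) y)"
proof -
  have "power_sum n r y * mono_sym n b y =
      (\<Sum>\<pi> | \<pi> permutes {1..n}. power_sum n r y * (\<Prod>i=1..n. y (\<pi> i) ^ b i))"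
    by (simp add: mono_sym_def sum_distrib_left)
  also have "\<dots> = (\<Sum>\<pi> | \<pi> permutes {1..n}. \<Sum>j=1..n. \<Prod>i=1..n. y (\<pi> i) ^ (b(j := b j + r)) i)"
  proof (rule sum.cong[OF refl])
    fix \<pi> assume "\<pi> \<in> {\<pi>. \<pi> permutes {1..n}}"
    then have p: "\<pi> permutes {1..n}" by simp
    have "power_sum n r y = (\<Sum>j=1..n. y (\<pi> j) ^ r)"
      unfolding power_sum_def using sum.permute[OF p, of "\<lambda>i. y i ^ r"] by (simp add: comp_def)
    moreover have "y (\<pi> j) ^ r * (\<Prod>i=1..n. y (\<pi> i) ^ b i) = (\<Prod>i=1..n. y (\<pi> i) ^ (b(j := b j + r)) i)"
      if j: "j \<in> {1..n}" for j
    proof -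
      have "(\<Prod>i\<in>{1..n} - {j}. y (\<pi> i) ^ (b(j := b j + r)) i) = (\<Prod>i\<in>{1..n} - {j}. y (\<pi> i) ^ b i)"
        by (intro prod.cong) auto
      then show ?thesis
        unfolding prod.remove[OF finite_atLeastAtMost j] by (simp add: power_add mult_ac)
    qed
    ultimately show "power_sum n r y * (\<Prod>i=1..n. y (\<pi> i) ^ b i) =
        (\<Sum>j=1..n. \<Prod>i=1..n. y (\<pi> i) ^ (b(j := b j + r)) i)"
      by (simp add: sum_distrib_right)
  qed
  also have "\<dots> = (\<Sum>j=1..n. mono_sym n (b(j := b j + r)) y)"
    unfolding mono_sym_def by (rule sum.swap)
  finally show ?thesis .
qed

lemma prod_add_elem_sym: "(\<Prod>j=1..n. t + y j) = (\<Sum>i=0..n. elem_sym n i y * t ^ (n - i))"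
proof -
  have "(\<Prod>j=1..n. t + y j) = (\<Sum>S\<in>Pow {1..n}. (\<Prod>j\<in>S. y j) * t ^ (n - card S))"
    using prod_add[of "{1..n}" y "\<lambda>_. t"]
    by (simp add: add.commute card_Diff_subset finite_subset cong: sum.cong)
       (intro sum.cong refl, simp add: card_Diff_subset finite_subset)
  also have "\<dots> = (\<Sum>i=0..n. \<Sum>S | S \<in> Pow {1..n} \<and> card S = i. (\<Prod>j\<in>S. y j) * t ^ (n - card S))"
    by (rule sum.group[symmetric]) (auto dest!: card_mono[rotated])
  also have "\<dots> = (\<Sum>i=0..n. elem_sym n i y * t ^ (n - i))"
    unfolding elem_sym_def sum_distrib_right by (intro sum.cong refl) auto
  finally show ?thesis .
qed

lemma fact_mult_elem_sym:
  "fact n * elem_sym n i y = (\<Sum>S | S \<subseteq> {1..n} \<and> card S = i. mono_sym n (\<lambda>j. of_bool (j \<in> S)) y)"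
proof -
  have ind: "(\<Prod>j=1..n. y (\<pi> j) ^ of_bool (j \<in> S)) = (\<Prod>j\<in>S. y (\<pi> j))" if "S \<subseteq> {1..n}" for S \<pi>
    using that by (intro prod.mono_neutral_cong_right) auto
  have "(\<Sum>S | S \<subseteq> {1..n} \<and> card S = i. mono_sym n (\<lambda>j. of_bool (j \<in> S)) y) =
      (\<Sum>\<pi> | \<pi> permutes {1..n}. \<Sum>S | S \<subseteq> {1..n} \<and> card S = i. \<Prod>j=1..n. y (\<pi> j) ^ of_bool (j \<in> S))"
    unfolding mono_sym_def by (rule sum.swap)
  also have "\<dots> = (\<Sum>\<pi> | \<pi> permutes {1..n}. elem_sym n i y)"
  proof (rule sum.cong[OF refl])
    fix \<pi> assume "\<pi> \<in> {\<pi>. \<pi> permutes {1..n}}"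
    then have p: "\<pi> permutes {1..n}" by simp
    have inj: "inj_on \<pi> S" "inj_on (inv \<pi>) S" for S
      using permutes_inj[OF p] permutes_inj[OF permutes_inv[OF p]] by (auto intro: inj_on_subset)
    have img: "\<pi> ` S \<subseteq> {1..n}" "inv \<pi> ` S \<subseteq> {1..n}" if "S \<subseteq> {1..n}" for S
      using that permutes_in_image[OF p] permutes_in_image[OF permutes_inv[OF p]] by blast+
    show "(\<Sum>S | S \<subseteq> {1..n} \<and> card S = i. \<Prod>j=1..n. y (\<pi> j) ^ of_bool (j \<in> S)) = elem_sym n i y"
      unfolding elem_sym_def
      by (rule sum.reindex_bij_witness[of _ "\<lambda>S. inv \<pi> ` S" "\<lambda>S. \<pi> ` S"])
         (use p inj img in \<open>auto simp: ind image_image permutes_inverses card_image prod.reindex simp del: One_nat_def\<close>)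
  qed
  finally show ?thesis
    by (simp add: card_permutations[OF refl])
qed

section \<open>Reduction of symmetrized monomials to power sums of the squares\<close>

definition sq_var :: "nat \<Rightarrow> rpoly"
  where "sq_var i = Var i ^ 2"

abbreviation sq_power_sum :: "nat \<Rightarrow> nat \<Rightarrow> rpoly"
  where "sq_power_sum n r \<equiv> power_sum n r sq_var"

abbreviation lower_algebra :: "nat \<Rightarrow> nat \<Rightarrow> rpoly set"
  where "lower_algebra n m \<equiv> generated_algebra (sq_power_sum n ` {1..<m})"

lemma lower_algebra_mono: "m \<le> m' \<Longrightarrow> lower_algebra n m \<subseteq> lower_algebra n m'"
  by (rule generated_algebra_subset) auto

lemma eq_Const_mult:
  assumes "k > 0" "of_nat k * X = Z"
  shows "X = Const (1 / real k) * Z"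
proof -
  have "Const (1 / real k) * (of_nat k * X) = Const (1 / real k * real k) * X"
    by (simp only: Const_mult Const_of_nat mult.assoc)
  then show ?thesis
    using assms by simp
qed

text \<open>Multiplying by the power sum of the exponent b_i the symmetrized monomial without the i-th
  variable gives n - s + 1 copies of the original one and otherwise monomials with smaller support.\<close>

lemma mono_sym_reduction:
  assumes "s = card (supp n b)" "1 \<le> s" "sum b {1..n} = m"
  shows "\<exists>D\<in>lower_algebra n m.
    mono_sym n b sq_var = Const (power_sum_weight n s) * sq_power_sum n m + D"
  using assms
proof (induction s arbitrary: b m rule: less_induct)
  case (less s)
  let ?P = "sq_power_sum n" and ?M = "\<lambda>b. mono_sym n b sq_var"
  obtain i where i: "i \<in> {1..n}" "b i \<noteq> 0"
    using less.prems by (metis (mono_tags, lifting) Collect_empty_eq card.empty not_one_le_zero)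
  define r b' where "r = b i" and "b' = b(i := 0)"
  have B': "supp n b' = supp n b - {i}"
    by (auto simp: b'_def)
  have card': "card (supp n b') = s - 1"
    unfolding B' using i less.prems by (simp add: card_Diff_singleton)
  have sum_upd: "sum (b'(j := b' j + r)) {1..n} = sum b' {1..n} + r" if "j \<in> {1..n}" for j
  proof -
    have "sum (b'(j := b' j + r)) {1..n} = (\<Sum>l=1..n. b' l + (if l = j then r else 0))"
      by (intro sum.cong) auto
    then show ?thesis
      using that by (simp add: sum.distrib)
  qed
  have m: "m = sum b' {1..n} + r"
  proof -
    have "b = b'(i := b' i + r)"
      by (auto simp: b'_def r_def)
    then show ?thesis
      using sum_upd[OF i(1)] less.prems(3) by simp
  qed
  \<comment> \<open>Outside the support of \<open>b'\<close>, position i included, adding r puts the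
    removed exponent into an empty position. The result is a transposed copy of
    \<open>b\<close>.\<close>
  have outside: "?M (b'(j := b' j + r)) = ?M b" if j: "j \<in> {1..n} - supp n b'" for j
  proof -
    have t: "transpose i j permutes {1..n}"
      using i j by (auto intro: permutes_swap_id)
    have "?M (b'(j := b' j + r)) = ?M (\<lambda>l. b (transpose i j l))"
      by (rule mono_sym_cong) (use j in \<open>auto simp: b'_def r_def transpose_def split: if_splits\<close>)
    then show ?thesis
      by (simp add: mono_sym_compose[OF t])
  qed
  have fin: "finite (supp n b')"
    by simp
  have "card (supp n b) \<le> card {1..n}"
    by (rule card_mono) auto
  then have sn: "s \<le> n"
    unfolding less.prems(1) by simp
  have "card ({1..n} - supp n b') = n - (s - 1)"
    using card' by (subst card_Diff_subset) auto
  then have co: "card ({1..n} - supp n b') = n - s + 1"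
    using sn less.prems(2) by simp
  have "?P r * ?M b' = (\<Sum>j\<in>{1..n} - supp n b'. ?M (b'(j := b' j + r))) + (\<Sum>j\<in>supp n b'. ?M (b'(j := b' j + r)))"
    unfolding power_sum_mult_mono_sym by (rule sum.subset_diff) auto
  also have "(\<Sum>j\<in>{1..n} - supp n b'. ?M (b'(j := b' j + r))) = (\<Sum>j\<in>{1..n} - supp n b'. ?M b)"
    by (rule sum.cong[OF refl outside])
  also have "\<dots> = of_nat (n - s + 1) * ?M b"
    unfolding sum_constant co ..
  finally have "of_nat (n - s + 1) * ?M b = ?P r * ?M b' - (\<Sum>j\<in>supp n b'. ?M (b'(j := b' j + r)))"
    by (simp only: eq_diff_eq)
  then have eq: "?M b = Const (1 / real (n - s + 1)) * (?P r * ?M b' - (\<Sum>j\<in>supp n b'. ?M (b'(j := b' j + r))))"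
    by (rule eq_Const_mult[rotated]) simp
  show ?case
  proof (cases "s = 1")
    case True
    then have "supp n b' = {}"
      using card' by simp
    then have z: "b' j = 0" if "j \<in> {1..n}" for j
      using that by auto
    have M: "?M b' = ?M (\<lambda>_. 0)"
      by (rule mono_sym_cong) (simp add: z)
    have "m = r" "n - s + 1 = n"
      using m z True sn by simp_all
    then have "?M b = Const (1 / real n) * (?P m * fact n)"
      using eq unfolding \<open>supp n b' = {}\<close> M mono_sym_zero by (simp only: sum.empty diff_zero)
    also have "\<dots> = Const (1 / real n * fact n) * ?P m"
      by (simp only: Const_mult Const_fact mult_ac)
    also have "1 / real n * fact n = power_sum_weight n s"
      using True sn by (simp add: power_sum_weight_def fact_reduce)
    finally show ?thesis
      using generated_algebra.Const[of 0] by (intro bexI[of _ 0]) auto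
  next
    case False
    then have s2: "1 \<le> s - 1" "s - 1 < s"
      using less.prems(2) by auto
    \<comment> \<open>Inside the support r merges with another exponent: the degree is still m and
      the support has size s - 1, so \<open>?P m\<close> appears with the weight for s - 1.\<close>
    have "\<exists>D\<in>lower_algebra n m. ?M (b'(j := b' j + r)) = Const (power_sum_weight n (s - 1)) * ?P m + D"
      if j: "j \<in> supp n b'" for j
    proof (rule less.IH)
      have "supp n (b'(j := b' j + r)) = supp n b'"
        using j by auto
      then show "s - 1 = card (supp n (b'(j := b' j + r)))"
        by (simp only: card')
      show "sum (b'(j := b' j + r)) {1..n} = m"
        using sum_upd j m by simp
    qed (use s2 in auto)
    then have "\<forall>j\<in>supp n b'. \<exists>D. D \<in> lower_algebra n m \<and>
        ?M (b'(j := b' j + r)) = Const (power_sum_weight n (s - 1)) * ?P m + D"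
      by blast
    from bchoice[OF this] obtain D where D: "\<And>j. j \<in> supp n b' \<Longrightarrow> D j \<in> lower_algebra n m"
      "\<And>j. j \<in> supp n b' \<Longrightarrow> ?M (b'(j := b' j + r)) = Const (power_sum_weight n (s - 1)) * ?P m + D j"
      by blast
    have "supp n b' \<noteq> {}"
      using card' s2 by (metis card.empty not_one_le_zero)
    then obtain j where j: "j \<in> {1..n}" "b' j \<noteq> 0"
      by auto
    then have "sum b' {1..n} \<noteq> 0"
      by (metis finite_atLeastAtMost sum_eq_0_iff)
    moreover have "r > 0"
      using i by (simp add: r_def)
    moreover have "r \<in> {1..<t + r} \<and> (t + r) - r \<in> {1..<t + r} \<and> t = (t + r) - r" if "t \<noteq> 0" "r > 0" for t
      using that by auto
    \<comment> \<open>For s \<ge> 2 something is left after removing r, so r and m - r are both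
      positive and below m. The product \<open>?P r * ?M b'\<close> then lies in the lower algebra
      and contributes nothing to the coefficient of \<open>?P m\<close>.\<close>
    ultimately have rm: "r \<in> {1..<m}" "m - r \<in> {1..<m}" "sum b' {1..n} = m - r"
      unfolding m by blast+
    obtain D' where D': "D' \<in> lower_algebra n (m - r)" "?M b' = Const (power_sum_weight n (s - 1)) * ?P (m - r) + D'"
      using less.IH[OF s2(2) card'[symmetric] s2(1) rm(3)] by auto
    have PG: "?P l \<in> lower_algebra n m" if "l \<in> {1..<m}" for l
      using that by (intro generated_algebra.gen) auto
    have "?M b' \<in> lower_algebra n m"
      unfolding D'(2) using D'(1) lower_algebra_mono[of "m - r" m n] PG[OF rm(2)]
      by (intro generated_algebra.add generated_algebra.mult generated_algebra.Const) auto
    then have E: "Const (1 / real (n - s + 1)) * (?P r * ?M b' - (\<Sum>j\<in>supp n b'. D j)) \<in> lower_algebra n m"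
      using PG[OF rm(1)] D(1)
      by (auto intro!: generated_algebra.mult generated_algebra.Const generated_algebra_diff generated_algebra_sum)
    \<comment> \<open>This recursion, started at (n - 1)! for s = 1, is the origin of the closed
      form of the weight.\<close>
    have w: "power_sum_weight n s = - (1 / real (n - s + 1)) * (real (s - 1) * power_sum_weight n (s - 1))"
    proof -
      have "n - (s - 1) = Suc (n - s)" "s - 1 = Suc (s - 2)" "s - 1 - 1 = s - 2"
        using sn s2 by auto
      then show ?thesis
        unfolding power_sum_weight_def by (simp add: field_simps)
    qed
    have "(\<Sum>j\<in>supp n b'. ?M (b'(j := b' j + r))) =
        of_nat (s - 1) * (Const (power_sum_weight n (s - 1)) * ?P m) + (\<Sum>j\<in>supp n b'. D j)"
    proof -
      have "(\<Sum>j\<in>supp n b'. ?M (b'(j := b' j + r))) =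
          (\<Sum>j\<in>supp n b'. Const (power_sum_weight n (s - 1)) * ?P m + D j)"
        by (rule sum.cong[OF refl D(2)])
      then show ?thesis
        unfolding sum.distrib sum_constant card' .
    qed
    then have "?M b = Const (power_sum_weight n s) * ?P m +
        Const (1 / real (n - s + 1)) * (?P r * ?M b' - (\<Sum>j\<in>supp n b'. D j))"
      unfolding eq w Const_mult Const_uminus Const_of_nat by (simp add: algebra_simps)
    then show ?thesis
      using E by blast
  qed
qed

lemma mono_sym_combination:
  assumes "finite B" "1 \<le> m" "\<And>b. b \<in> B \<Longrightarrow> sum b {1..n} = m"
  shows "\<exists>D\<in>lower_algebra n m. (\<Sum>b\<in>B. Const (a b) * mono_sym n b sq_var) =
    Const (\<Sum>b\<in>B. a b * power_sum_weight n (card (supp n b))) * sq_power_sum n m + D"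
proof -
  have "\<exists>D\<in>lower_algebra n m. mono_sym n b sq_var =
      Const (power_sum_weight n (card (supp n b))) * sq_power_sum n m + D" if b: "b \<in> B" for b
  proof (rule mono_sym_reduction)
    have "supp n b \<noteq> {}"
    proof
      assume "supp n b = {}"
      then have "sum b {1..n} = 0"
        by (intro sum.neutral) auto
      then show False
        using assms(2) assms(3)[OF b] by linarith
    qed
    then show "1 \<le> card (supp n b)"
      by (simp add: Suc_le_eq card_gt_0_iff)
  qed (use assms b in auto)
  then have "\<forall>b\<in>B. \<exists>D. D \<in> lower_algebra n m \<and> mono_sym n b sq_var =
      Const (power_sum_weight n (card (supp n b))) * sq_power_sum n m + D"
    by blast
  from bchoice[OF this] obtain D where D: "\<And>b. b \<in> B \<Longrightarrow> D b \<in> lower_algebra n m"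
    "\<And>b. b \<in> B \<Longrightarrow> mono_sym n b sq_var =
      Const (power_sum_weight n (card (supp n b))) * sq_power_sum n m + D b"
    by blast
  have "(\<Sum>b\<in>B. Const (a b) * mono_sym n b sq_var) =
      (\<Sum>b\<in>B. Const (a b * power_sum_weight n (card (supp n b))) * sq_power_sum n m + Const (a b) * D b)"
    by (intro sum.cong refl) (simp add: D(2) Const_mult algebra_simps)
  also have "\<dots> = Const (\<Sum>b\<in>B. a b * power_sum_weight n (card (supp n b))) * sq_power_sum n m
      + (\<Sum>b\<in>B. Const (a b) * D b)"
    by (simp add: sum.distrib Const_sum sum_distrib_right)
  finally have "(\<Sum>b\<in>B. Const (a b) * mono_sym n b sq_var) =
      Const (\<Sum>b\<in>B. a b * power_sum_weight n (card (supp n b))) * sq_power_sum n m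
      + (\<Sum>b\<in>B. Const (a b) * D b)" .
  moreover have "(\<Sum>b\<in>B. Const (a b) * D b) \<in> lower_algebra n m"
    by (intro generated_algebra_sum generated_algebra.mult generated_algebra.Const D(1))
  ultimately show ?thesis
    by blast
qed

text \<open>The elementary symmetric polynomial is 1/n! times the sum of the symmetrized indicator
  vectors of the i-element sets, all of support size i. Its leading coefficient is (-1)^(i-1)/i, as
  in Newton's identities.\<close>

lemma elem_sym_reduction:
  assumes "1 \<le> i" "i \<le> n"
  shows "\<exists>c D. c \<noteq> 0 \<and> D \<in> lower_algebra n i \<and> elem_sym n i sq_var = Const c * sq_power_sum n i + D"
proof -
  let ?F = "{S. S \<subseteq> {1..n} \<and> card S = i}"
  let ?I = "\<lambda>S j. of_bool (j \<in> S) :: nat"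
  have finF: "finite ?F"
    by simp
  have inj: "inj_on ?I ?F"
    by (intro inj_onI) (auto simp: fun_eq_iff of_bool_eq_iff)
  have supp: "supp n (?I S) = S" if "S \<in> ?F" for S
    using that by auto
  have "\<exists>D\<in>lower_algebra n i. (\<Sum>b\<in>?I ` ?F. Const (1 / fact n) * mono_sym n b sq_var) =
      Const (\<Sum>b\<in>?I ` ?F. 1 / fact n * power_sum_weight n (card (supp n b))) * sq_power_sum n i + D"
  proof (rule mono_sym_combination)
    fix b assume "b \<in> ?I ` ?F"
    then obtain S where S: "S \<subseteq> {1..n}" "card S = i" "b = ?I S"
      by auto
    then have "sum b {1..n} = sum b S"
      by (intro sum.mono_neutral_right) auto
    then show "sum b {1..n} = i"
      using S by simp
  qed (use assms in auto)
  then obtain D where D: "D \<in> lower_algebra n i" "(\<Sum>b\<in>?I ` ?F. Const (1 / fact n) * mono_sym n b sq_var) =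
      Const (\<Sum>b\<in>?I ` ?F. 1 / fact n * power_sum_weight n (card (supp n b))) * sq_power_sum n i + D"
    by blast
  have "(\<Sum>b\<in>?I ` ?F. Const (1 / fact n) * mono_sym n b sq_var) = Const (1 / fact n) * (fact n * elem_sym n i sq_var)"
    unfolding fact_mult_elem_sym sum.reindex[OF inj] sum_distrib_left comp_def ..
  also have "\<dots> = Const (1 / fact n * fact n) * elem_sym n i sq_var"
    by (simp only: Const_mult Const_fact mult.assoc)
  finally have E: "(\<Sum>b\<in>?I ` ?F. Const (1 / fact n) * mono_sym n b sq_var) = elem_sym n i sq_var"
    by simp
  have C: "(\<Sum>b\<in>?I ` ?F. 1 / fact n * power_sum_weight n (card (supp n b))) =
      real (n choose i) * (1 / fact n * power_sum_weight n i)"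
  proof -
    have "(\<Sum>b\<in>?I ` ?F. 1 / fact n * power_sum_weight n (card (supp n b))) =
        (\<Sum>S\<in>?F. 1 / fact n * power_sum_weight n i)"
      unfolding sum.reindex[OF inj] comp_def using supp by (intro sum.cong refl) auto
    then show ?thesis
      using n_subsets[of "{1..n}" i] by simp
  qed
  have "real (n choose i) * (1 / fact n * power_sum_weight n i) \<noteq> 0"
    using assms by (simp add: power_sum_weight_def)
  then show ?thesis
    using D unfolding E C by blast
qed

text \<open>For r > n, -y_l is a root of the product of the t + y_j. Multiplying this equation by
  (-y_l)^(r-n) and summing over l gives Newton's relation, which expresses
  \<open>sq_power_sum n r\<close> through earlier power sums with elementary symmetric
  coefficients.\<close>

lemma sq_power_sum_in_algebra:
  assumes "1 \<le> r"
  shows "sq_power_sum n r \<in> generated_algebra (sq_power_sum n ` {1..n})"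
  using assms
proof (induction r rule: less_induct)
  case (less r)
  let ?G = "generated_algebra (sq_power_sum n ` {1..n})"
  show ?case
  proof (cases "r \<le> n")
    case True
    then show ?thesis
      using less.prems by (intro generated_algebra.gen) auto
  next
    case False
    have E: "elem_sym n i sq_var \<in> ?G" if i: "i \<in> {1..n}" for i
    proof -
      obtain c D where D: "D \<in> lower_algebra n i" and eq: "elem_sym n i sq_var = Const c * sq_power_sum n i + D"
        using elem_sym_reduction[of i n] i by auto
      have sub: "lower_algebra n i \<subseteq> ?G"
        using i by (intro generated_algebra_subset) auto
      have "sq_power_sum n i \<in> ?G"
        using i by (intro generated_algebra.gen imageI)
      then show ?thesis
        unfolding eq by (intro generated_algebra.add generated_algebra.mult generated_algebra.Const subsetD[OF sub D])
    qed
    have z: "(\<Sum>i=0..n. elem_sym n i sq_var * (- sq_var l) ^ (n - i)) = 0" if "l \<in> {1..n}" for l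
      unfolding prod_add_elem_sym[symmetric] using that by (auto intro!: prod_zero bexI[of _ l])
    have "0 = (\<Sum>l=1..n. (- sq_var l) ^ (r - n) * (\<Sum>i=0..n. elem_sym n i sq_var * (- sq_var l) ^ (n - i)))"
      by (simp add: z)
    also have "\<dots> = (\<Sum>l=1..n. \<Sum>i=0..n. elem_sym n i sq_var * ((-1) ^ (r - i) * sq_var l ^ (r - i)))"
      unfolding sum_distrib_left
    proof (intro sum.cong refl)
      fix l i assume "i \<in> {0..n}"
      then have "(- sq_var l) ^ (r - n) * (- sq_var l) ^ (n - i) = (- sq_var l) ^ (r - i)"
        using False by (simp flip: power_add)
      then show "(- sq_var l) ^ (r - n) * (elem_sym n i sq_var * (- sq_var l) ^ (n - i)) =
        elem_sym n i sq_var * ((-1) ^ (r - i) * sq_var l ^ (r - i))"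
        by (simp add: power_minus[of "sq_var l" "r - i"] mult_ac)
    qed
    also have "\<dots> = (\<Sum>i=0..n. elem_sym n i sq_var * ((-1) ^ (r - i) * sq_power_sum n (r - i)))"
      unfolding power_sum_def sum_distrib_left by (rule sum.swap)
    also have "\<dots> = (-1) ^ r * sq_power_sum n r +
        (\<Sum>i=1..n. elem_sym n i sq_var * ((-1) ^ (r - i) * sq_power_sum n (r - i)))"
    proof -
      have "elem_sym n 0 sq_var = 1"
      proof -
        have "{S. S \<subseteq> {1..n} \<and> card S = 0} = {{}}"
          by (auto simp: finite_subset)
        then show ?thesis
          by (simp add: elem_sym_def)
      qed
      then show ?thesis
        by (simp add: sum.atLeast_Suc_atMost)
    qed
    finally have eq: "(-1) ^ r * sq_power_sum n r =
        - (\<Sum>i=1..n. elem_sym n i sq_var * ((-1) ^ (r - i) * sq_power_sum n (r - i)))"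
      by (simp add: eq_neg_iff_add_eq_0)
    have sgn: "(-1) ^ k \<in> ?G" for k
      using generated_algebra.Const[of 1] generated_algebra.Const[of "-1"]
      by (cases "even k") (auto simp: Const_uminus)
    have "(-1) ^ r * sq_power_sum n r \<in> ?G"
      unfolding eq
    proof (intro generated_algebra_uminus generated_algebra_sum generated_algebra.mult E sgn)
      \<comment> \<open>Since i \<le> n < r, the index r - i is at least 1, as the induction
        hypothesis requires.\<close>
      fix i assume "i \<in> {1..n}"
      then show "sq_power_sum n (r - i) \<in> ?G"
        using False by (intro less.IH) auto
    qed
    then show ?thesis
      using generated_algebra_uminus[of "(-1) ^ r * sq_power_sum n r"] by (cases "even r") auto
  qed
qed

section \<open>Averaging over the group\<close>

lemma finite_W_group [simp]: "finite (W_group n)"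
  unfolding W_group_def by (intro finite_cartesian_product finite_permutations finite_PiE) auto

text \<open>Running over inverses undoes the \<open>inv\<close> in \<open>W_act\<close>, so that the
  sums involve \<open>x (\<pi> i)\<close> as in \<open>mono_sym\<close>.\<close>

lemma sum_W_group: "(\<Sum>\<sigma>\<in>W_group n. f \<sigma>) =
    (\<Sum>\<pi> | \<pi> permutes {1..n}. \<Sum>\<epsilon>\<in>{1..n} \<rightarrow>\<^sub>E {1, -1}. f (inv \<pi>, \<epsilon>))"
proof -
  have "(\<Sum>\<sigma>\<in>W_group n. f \<sigma>) = (\<Sum>\<pi> | \<pi> permutes {1..n}. \<Sum>\<epsilon>\<in>{1..n} \<rightarrow>\<^sub>E {1, -1}. f (\<pi>, \<epsilon>))"
    unfolding W_group_def by (simp add: sum.cartesian_product)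
  also have "\<dots> = (\<Sum>\<pi> | \<pi> permutes {1..n}. \<Sum>\<epsilon>\<in>{1..n} \<rightarrow>\<^sub>E {1, -1}. f (inv \<pi>, \<epsilon>))"
    by (rule sum.reindex_bij_witness[of _ inv inv]) (auto simp: permutes_inv permutes_inv_inv)
  finally show ?thesis .
qed

text \<open>The sum over the signs factors over the coordinates, and each factor 1 + (-1)^(\<mu> i)
  is 2 or 0.\<close>

lemma sum_W_group_monomial:
  fixes x :: "nat \<Rightarrow> 'a :: comm_ring_1"
  shows "(\<Sum>\<sigma>\<in>W_group n. \<Prod>i=1..n. W_act \<sigma> x i ^ \<mu> i) =
    (if \<forall>i\<in>{1..n}. even (\<mu> i) then 2 ^ n * mono_sym n \<mu> x else 0)"
proof -
  have "(\<Sum>\<sigma>\<in>W_group n. \<Prod>i=1..n. W_act \<sigma> x i ^ \<mu> i) =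
      (\<Sum>\<pi> | \<pi> permutes {1..n}. \<Sum>\<epsilon>\<in>{1..n} \<rightarrow>\<^sub>E {1, -1}. \<Prod>i=1..n. of_int (\<epsilon> i) ^ \<mu> i * x (\<pi> i) ^ \<mu> i)"
    unfolding sum_W_group
    by (intro sum.cong refl) (simp add: W_act_def permutes_inv_inv power_mult_distrib)
  also have "\<dots> = (\<Sum>\<pi> | \<pi> permutes {1..n}.
      (\<Prod>i=1..n. \<Sum>e\<in>{1, -1}. of_int e ^ \<mu> i) * (\<Prod>i=1..n. x (\<pi> i) ^ \<mu> i))"
    by (subst prod_sum_PiE) (simp_all add: prod.distrib sum_distrib_right)
  also have "\<dots> = (\<Prod>i=1..n. \<Sum>e\<in>{1, -1}. of_int e ^ \<mu> i) * mono_sym n \<mu> x"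
    by (simp add: mono_sym_def sum_distrib_left)
  also have "(\<Prod>i=1..n. \<Sum>e\<in>{1, -1 :: int}. of_int e ^ \<mu> i :: 'a) =
      (if \<forall>i\<in>{1..n}. even (\<mu> i) then 2 ^ n else 0)"
  proof (cases "\<forall>i\<in>{1..n}. even (\<mu> i)")
    case True
    then have "(\<Prod>i=1..n. \<Sum>e\<in>{1, -1 :: int}. of_int e ^ \<mu> i :: 'a) = (\<Prod>i=1..n. 2)"
      by (intro prod.cong refl) auto
    then show ?thesis
      using True by simp
  next
    case False
    then obtain i where "i \<in> {1..n}" "odd (\<mu> i)"
      by blast
    then have "(\<Prod>i=1..n. \<Sum>e\<in>{1, -1 :: int}. of_int e ^ \<mu> i :: 'a) = 0"
      by (intro prod_zero bexI[of _ i]) auto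
    then show ?thesis
      unfolding if_not_P[OF False] .
  qed
  finally show ?thesis
    by simp
qed

lemma mono_sym_even: "(\<And>i. i \<in> {1..n} \<Longrightarrow> \<mu> i = 2 * b i) \<Longrightarrow> mono_sym n \<mu> x = mono_sym n b (\<lambda>i. x i ^ 2)"
  unfolding mono_sym_def by (intro sum.cong prod.cong refl) (simp add: power_mult)

lemma sq_var_fun: "(\<lambda>i. Var i ^ 2) = sq_var"
  by (simp add: sq_var_def fun_eq_iff)

lemma mono_sym_in_algebra: "mono_sym n b sq_var \<in> generated_algebra (sq_power_sum n ` {1..n})"
proof -
  let ?G = "generated_algebra (sq_power_sum n ` {1..n})"
  have sub: "lower_algebra n m \<subseteq> ?G" for m
    by (rule generated_algebra_mono) (metis atLeastLessThan_iff image_subsetI sq_power_sum_in_algebra)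
  show ?thesis
  proof (cases "supp n b = {}")
    case True
    then have "mono_sym n b sq_var = mono_sym n (\<lambda>_. 0) sq_var"
      by (intro mono_sym_cong) auto
    then show ?thesis
      using generated_algebra.Const[of "fact n"] Const_of_nat[of "fact n"] by (simp add: mono_sym_zero)
  next
    case False
    then have c: "1 \<le> card (supp n b)"
      by (simp add: Suc_le_eq card_gt_0_iff)
    obtain i where i: "i \<in> {1..n}" "b i \<noteq> 0"
      using False by auto
    then have "sum b {1..n} \<noteq> 0"
      by (metis finite_atLeastAtMost sum_eq_0_iff)
    then have "sq_power_sum n (sum b {1..n}) \<in> ?G"
      by (intro sq_power_sum_in_algebra) (simp only: One_nat_def Suc_le_eq neq0_conv)
    moreover obtain D where D: "D \<in> lower_algebra n (sum b {1..n})"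
      and eq: "mono_sym n b sq_var =
        Const (power_sum_weight n (card (supp n b))) * sq_power_sum n (sum b {1..n}) + D"
      using mono_sym_reduction[OF refl c refl] by blast
    ultimately show ?thesis
      unfolding eq by (intro generated_algebra.add generated_algebra.mult generated_algebra.Const subsetD[OF sub D])
  qed
qed

text \<open>An invariant equals its average over the group, and averaging a monomial gives zero or a
  multiple of a symmetrized monomial in the squares.\<close>

lemma W_invariants_subset: "W_invariants n \<subseteq> generated_algebra (sq_power_sum n ` {1..n})"
proof
  let ?G = "generated_algebra (sq_power_sum n ` {1..n})"
  fix p assume p: "p \<in> W_invariants n"
  \<comment> \<open>The identity element shows that the order of the group is positive and can be
    divided out.\<close>
  have "(id, \<lambda>i\<in>{1..n}. 1) \<in> W_group n"
    by (auto simp: W_group_def permutes_id)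
  then have card: "card (W_group n) > 0"
    by (auto simp: card_gt_0_iff)
  have mon: "(\<Sum>\<sigma>\<in>W_group n. mon_eval (W_act \<sigma> Var) m) \<in> ?G" if m: "m \<in> Poly_Mapping.keys p" for m
  proof -
    let ?\<mu> = "Poly_Mapping.lookup m"
    have "Poly_Mapping.keys m \<subseteq> {1..n}"
      using p m by (auto simp: W_invariants_def poly_ring_def vars_def)
    then have "(\<Sum>\<sigma>\<in>W_group n. mon_eval (W_act \<sigma> Var) m) = (\<Sum>\<sigma>\<in>W_group n. \<Prod>i=1..n. W_act \<sigma> Var i ^ ?\<mu> i)"
      by (intro sum.cong refl mon_eval_superset) auto
    also have "\<dots> \<in> ?G"
    proof (cases "\<forall>i\<in>{1..n}. even (?\<mu> i)")
      case True
      then have "mono_sym n ?\<mu> Var = mono_sym n (\<lambda>i. ?\<mu> i div 2) (\<lambda>i. Var i ^ 2)"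
        by (intro mono_sym_even) auto
      moreover have "2 ^ n \<in> ?G"
        using generated_algebra.Const[of "2 ^ n"] Const_of_nat[of "2 ^ n"] by simp
      ultimately show ?thesis
        using True mono_sym_in_algebra
        unfolding sum_W_group_monomial by (simp add: generated_algebra.mult sq_var_fun)
    next
      case False
      then show ?thesis
        unfolding sum_W_group_monomial using generated_algebra.Const[of 0] by auto
    qed
    finally show ?thesis .
  qed
  have "of_nat (card (W_group n)) * p = (\<Sum>\<sigma>\<in>W_group n. W_pullback \<sigma> p)"
    using p by (simp add: W_invariants_def)
  also have "\<dots> = (\<Sum>m\<in>Poly_Mapping.keys p. Const (Poly_Mapping.lookup p m) * (\<Sum>\<sigma>\<in>W_group n. mon_eval (W_act \<sigma> Var) m))"
    unfolding W_pullback_eq_ev poly_ev.ev_def sum_distrib_left by (rule sum.swap)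
  finally have "p = Const (1 / real (card (W_group n))) *
    (\<Sum>m\<in>Poly_Mapping.keys p. Const (Poly_Mapping.lookup p m) * (\<Sum>\<sigma>\<in>W_group n. mon_eval (W_act \<sigma> Var) m))"
    by (rule eq_Const_mult[OF card])
  then show "p \<in> ?G"
    using mon by (metis (no_types, lifting) generated_algebra.mult generated_algebra.Const generated_algebra_sum)
qed

lemma sq_power_sum_invariant: "sq_power_sum n r \<in> W_invariants n"
proof -
  have "vars (\<Sum>i\<in>A. f i) \<subseteq> (\<Union>i\<in>A. vars (f i))" if "finite A" for A and f :: "nat \<Rightarrow> rpoly"
    using that
  proof (induction A)
    case empty
    show ?case by (simp add: vars_def)
  next
    case (insert a A)
    then show ?case
      using vars_add[of "f a" "sum f A"] by auto
  qed
  moreover have "vars (p ^ k) \<subseteq> vars p" for p k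
  proof (induction k)
    case 0
    show ?case using vars_Const[of 1] by simp
  next
    case (Suc k)
    then show ?case using vars_mult[of p "p ^ k"] by auto
  qed
  then have "vars (sq_var i ^ k) \<subseteq> {i}" for i k
    unfolding sq_var_def using vars_Var by blast
  ultimately have "vars (sq_power_sum n r) \<subseteq> {1..n}"
    unfolding power_sum_def by (fastforce dest!: subsetD)
  moreover have "W_pullback \<sigma> (sq_power_sum n r) = sq_power_sum n r" if "\<sigma> \<in> W_group n" for \<sigma>
  proof -
    define \<pi> \<epsilon> where "\<pi> = fst \<sigma>" and "\<epsilon> = snd \<sigma>"
    then have \<sigma>: "\<sigma> = (\<pi>, \<epsilon>)" and \<pi>: "\<pi> permutes {1..n}" and \<epsilon>: "\<epsilon> \<in> {1..n} \<rightarrow>\<^sub>E {1, -1}"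
      using that by (simp_all add: W_group_def mem_Times_iff)
    have "of_int (\<epsilon> i) ^ 2 = (1 :: rpoly)" if "i \<in> {1..n}" for i
      using PiE_mem[OF \<epsilon> that] by auto
    then have "W_pullback \<sigma> (sq_power_sum n r) = (\<Sum>i=1..n. sq_var (inv \<pi> i) ^ r)"
      unfolding W_pullback_eq_ev power_sum_def
      by (simp add: poly_ev.ev_sum poly_ev.ev_power sq_var_def W_act_def \<sigma> power_mult_distrib)
    also have "\<dots> = sq_power_sum n r"
      unfolding power_sum_def using sum.permute[OF permutes_inv[OF \<pi>], of "\<lambda>i. sq_var i ^ r"]
      by (simp add: comp_def)
    finally show ?thesis .
  qed
  ultimately show ?thesis
    by (auto simp: W_invariants_def poly_ring_def)
qed

section \<open>The invariants as face integrals\<close>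

lemma H_poly_eq_fps: "H_poly j m t = fps_nth (\<Prod>i=1..j. geo (t i)) m"
proof -
  have "{\<mu>. \<mu> \<in> {1..j} \<rightarrow>\<^sub>E UNIV \<and> (\<Sum>i=1..j. \<mu> i) = m} = weak_comps {1..j} m"
    by (auto simp: weak_comps_def)
  then show ?thesis
    unfolding H_poly_def by (simp add: fps_prod_nth_weak_comps geo_def)
qed

lemma sum_list_map_upt: "sum_list (map z [a..<b]) = (\<Sum>l=a..<b. z l)"
  for z :: "nat \<Rightarrow> real"
  by (simp add: interv_sum_list_conv_sum_set_nat)

text \<open>The base of the flag is the tail s_(k+1), and the arguments are the suffix sums that
  enter h_m^(k). For k = n the tail is empty, in accordance with s_(n+1) = 0.\<close>

lemma flag_series_upt:
  assumes "j \<le> k + 1" "k \<le> n"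
  shows "flag_series (\<Sum>l=k+1..n. z l) (map z [j..<k+1]) = (\<Prod>i=j..k+1. geo (\<Sum>l=i..n. z l))"
  using assms(1)
proof (induction j rule: inc_induct)
  case (step j)
  have "(\<Sum>l=j..n. z l) = (\<Sum>l=j..<k+1. z l) + (\<Sum>l=k+1..n. z l)"
    using step.hyps assms(2) sum.atLeastLessThan_concat[of j "k+1" "n+1" z]
    by (simp add: atLeastLessThanSuc_atLeastAtMost)
  also have "(\<Sum>l=j..<k+1. z l) = z j + sum_list (map z [Suc j..<k+1])"
    unfolding sum_list_map_upt using step.hyps by (simp only: sum.atLeast_Suc_lessThan)
  finally have s: "(\<Sum>l=j..n. z l) = (\<Sum>l=k+1..n. z l) + z j + sum_list (map z [Suc j..<k+1])"
    by simp
  have "map z [j..<k+1] = z j # map z [Suc j..<k+1]"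
    using step.hyps by (simp only: upt_conv_Cons list.map)
  then have "flag_series (\<Sum>l=k+1..n. z l) (map z [j..<k+1]) =
      geo (\<Sum>l=j..n. z l) * (\<Prod>i=Suc j..k+1. geo (\<Sum>l=i..n. z l))"
    by (simp only: flag_series.simps s step.IH)
  also have "\<dots> = (\<Prod>i=j..k+1. geo (\<Sum>l=i..n. z l))"
    using step.hyps by (simp only: prod.atLeast_Suc_atMost less_imp_le)
  finally show ?case .
qed simp

lemma bij_betw_permutations_of_set_upt:
  "bij_betw (\<lambda>\<rho>. map \<rho> [1..<k+1]) {\<rho>. \<rho> permutes {1..k}} (permutations_of_set {1..k})"
proof -
  let ?g = "\<lambda>\<rho> :: nat \<Rightarrow> nat. map \<rho> [1..<k+1]"
  have set_upt: "set [1..<k+1] = {1..k}"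
    by auto
  have inj: "inj_on ?g {\<rho>. \<rho> permutes {1..k}}"
  proof (rule inj_onI)
    fix \<rho> \<rho>' assume a: "\<rho> \<in> {\<rho>. \<rho> permutes {1..k}}" "\<rho>' \<in> {\<rho>. \<rho> permutes {1..k}}" "?g \<rho> = ?g \<rho>'"
    then have "\<rho> i = \<rho>' i" if "i \<in> {1..k}" for i
      using that set_upt by (metis map_eq_conv)
    then show "\<rho> = \<rho>'"
      using a(1,2) by (intro ext) (metis mem_Collect_eq permutes_not_in)
  qed
  have "?g ` {\<rho>. \<rho> permutes {1..k}} = permutations_of_set {1..k}"
  proof (rule card_subset_eq)
    show "?g ` {\<rho>. \<rho> permutes {1..k}} \<subseteq> permutations_of_set {1..k}"
    proof
      fix xs assume "xs \<in> ?g ` {\<rho>. \<rho> permutes {1..k}}"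
      then obtain \<rho> where \<rho>: "\<rho> permutes {1..k}" "xs = ?g \<rho>"
        by auto
      show "xs \<in> permutations_of_set {1..k}"
      proof (rule permutations_of_setI)
        show "set xs = {1..k}"
          unfolding \<rho>(2) set_map set_upt by (rule permutes_image[OF \<rho>(1)])
        show "distinct xs"
          unfolding \<rho>(2) distinct_map using permutes_inj[OF \<rho>(1)] by (auto intro: inj_on_subset)
      qed
    qed
    show "card (?g ` {\<rho>. \<rho> permutes {1..k}}) = card (permutations_of_set {1..k})"
      unfolding card_image[OF inj] using card_permutations[of "{1..k}" k] by simp
  qed simp
  then show ?thesis
    using inj by (simp add: bij_betw_def)
qed

lemma fps_exp_sum: "finite A \<Longrightarrow> fps_exp (\<Sum>i\<in>A. z i) = (\<Prod>i\<in>A. fps_exp (z i :: real))"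
  by (induction A rule: finite_induct) (simp_all add: fps_exp_add_mult)

text \<open>Permuting the first k coordinates runs through the simplices that triangulate one
  k-face, so the sum factors by \<open>sum_flag_series_nth\<close>. An edge direction i \<le> k
  contributes (exp(z_i X) - 1)/(z_i X) and a fixed coordinate exp(z_i X); hence the factorial is
  shifted by one exactly for i \<le> k.\<close>

lemma sum_h_permutations:
  fixes z :: "nat \<Rightarrow> real"
  assumes "k \<le> n" and "\<And>S. S \<subseteq> {1..k} \<Longrightarrow> S \<noteq> {} \<Longrightarrow> sum z S \<noteq> 0"
  shows "(\<Sum>\<rho> | \<rho> permutes {1..k}. H_poly (k + 1) m (\<lambda>i. \<Sum>l=i..n. z (\<rho> l))) =
    fact (m + k) * (\<Sum>\<mu>\<in>weak_comps {1..n} m. \<Prod>i=1..n. z i ^ \<mu> i / fact (\<mu> i + of_bool (i \<le> k)))"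
proof -
  let ?r = "\<Sum>l=k+1..n. z l"
  have "(\<Sum>\<rho> | \<rho> permutes {1..k}. H_poly (k + 1) m (\<lambda>i. \<Sum>l=i..n. z (\<rho> l))) =
      (\<Sum>\<rho> | \<rho> permutes {1..k}. fps_nth (flag_series ?r (map z (map \<rho> [1..<k+1]))) m)"
  proof (rule sum.cong[OF refl])
    fix \<rho> assume "\<rho> \<in> {\<rho>. \<rho> permutes {1..k}}"
    then have "(\<Sum>l=k+1..n. z (\<rho> l)) = ?r"
      by (intro sum.cong refl) (simp add: permutes_not_in)
    then show "H_poly (k + 1) m (\<lambda>i. \<Sum>l=i..n. z (\<rho> l)) =
        fps_nth (flag_series ?r (map z (map \<rho> [1..<k+1]))) m"
      using flag_series_upt[of 1 k n "\<lambda>l. z (\<rho> l)"] assms(1)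
      by (simp add: H_poly_eq_fps comp_def del: upt_Suc)
  qed
  also have "\<dots> = (\<Sum>xs\<in>permutations_of_set {1..k}. fps_nth (flag_series ?r (map z xs)) m)"
    by (rule sum.reindex_bij_betw[OF bij_betw_permutations_of_set_upt])
  also have "\<dots> = fact (m + k) * fps_nth (fps_exp ?r * (\<Prod>i=1..k. expm1_div (z i))) m"
    using sum_flag_series_nth[of "{1..k}" z ?r m] assms(2) by simp
  also have "fps_exp ?r * (\<Prod>i=1..k. expm1_div (z i)) =
      (\<Prod>i=1..n. if i \<le> k then expm1_div (z i) else fps_exp (z i))"
  proof -
    have "(\<Prod>i=1..n. if i \<le> k then expm1_div (z i) else fps_exp (z i)) =
        (\<Prod>i=1..k. expm1_div (z i)) * (\<Prod>i=k+1..n. fps_exp (z i))"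
    proof -
      have "{1..n} = {1..k} \<union> {k+1..n}"
        using assms(1) by auto
      then have "(\<Prod>i=1..n. if i \<le> k then expm1_div (z i) else fps_exp (z i)) =
          (\<Prod>i=1..k. if i \<le> k then expm1_div (z i) else fps_exp (z i)) *
          (\<Prod>i=k+1..n. if i \<le> k then expm1_div (z i) else fps_exp (z i))"
        by (simp only:) (rule prod.union_disjoint, auto)
      also have "\<dots> = (\<Prod>i=1..k. expm1_div (z i)) * (\<Prod>i=k+1..n. fps_exp (z i))"
        by (intro arg_cong2[where f = "(*)"] prod.cong) auto
      finally show ?thesis .
    qed
    then show ?thesis
      by (simp add: fps_exp_sum mult.commute)
  qed
  also have "fps_nth \<dots> m = (\<Sum>\<mu>\<in>weak_comps {1..n} m. \<Prod>i=1..n. z i ^ \<mu> i / fact (\<mu> i + of_bool (i \<le> k)))"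
    unfolding fps_prod_nth_weak_comps[OF finite_atLeastAtMost]
    by (intro sum.cong prod.cong refl) (auto simp: expm1_div_def)
  finally show ?thesis .
qed

text \<open>Translation by \<rho> is a bijection of the group. The sign vector has to be permuted
  along with \<pi>, and it stays extensional because \<rho> fixes everything outside
  \<open>{1..n}\<close>.\<close>

lemma sum_W_group_compose:
  assumes "\<rho> permutes {1..n}"
  shows "(\<Sum>\<sigma>\<in>W_group n. f (W_act \<sigma> x)) = (\<Sum>\<sigma>\<in>W_group n. f (\<lambda>i. W_act \<sigma> x (\<rho> i)))"
proof -
  have inv: "inv \<rho> permutes {1..n}"
    by (rule permutes_inv[OF assms])
  have W: "(inv \<tau> \<circ> \<pi>, \<lambda>i. \<epsilon> (\<tau> i)) \<in> W_group n"
    if \<tau>: "\<tau> permutes {1..n}" and \<sigma>: "(\<pi>, \<epsilon>) \<in> W_group n" for \<tau> \<pi> \<epsilon>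
  proof -
    have \<pi>: "\<pi> permutes {1..n}" and \<epsilon>: "\<epsilon> \<in> {1..n} \<rightarrow>\<^sub>E {1, -1}"
      using \<sigma> by (simp_all add: W_group_def)
    have "(\<lambda>i. \<epsilon> (\<tau> i)) \<in> {1..n} \<rightarrow>\<^sub>E {1, -1}"
    proof (rule PiE_I)
      fix i assume "i \<in> {1..n}"
      then show "\<epsilon> (\<tau> i) \<in> {1, -1}"
        using PiE_mem[OF \<epsilon>] permutes_in_image[OF \<tau>] by blast
    next
      fix i assume "i \<notin> {1..n}"
      then show "\<epsilon> (\<tau> i) = undefined"
        using PiE_arb[OF \<epsilon>] permutes_not_in[OF \<tau>] by simp
    qed
    then show ?thesis
      using permutes_compose[OF \<pi> permutes_inv[OF \<tau>]] by (simp add: W_group_def)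
  qed
  show ?thesis
  proof (rule sum.reindex_bij_witness[of _ "\<lambda>(\<pi>, \<epsilon>). (inv \<rho> \<circ> \<pi>, \<lambda>i. \<epsilon> (\<rho> i))" "\<lambda>(\<pi>, \<epsilon>). (\<rho> \<circ> \<pi>, \<lambda>i. \<epsilon> (inv \<rho> i))"])
    fix \<sigma> assume "\<sigma> \<in> W_group n"
    moreover obtain \<pi> \<epsilon> where [simp]: "\<sigma> = (\<pi>, \<epsilon>)"
      by force
    ultimately have \<sigma>: "(\<pi>, \<epsilon>) \<in> W_group n"
      by simp
    show "(case case \<sigma> of (\<pi>, \<epsilon>) \<Rightarrow> (\<rho> \<circ> \<pi>, \<lambda>i. \<epsilon> (inv \<rho> i)) of (\<pi>, \<epsilon>) \<Rightarrow> (inv \<rho> \<circ> \<pi>, \<lambda>i. \<epsilon> (\<rho> i))) = \<sigma>"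
      using permutes_inverses[OF assms] by (simp add: fun_eq_iff)
    show "(case case \<sigma> of (\<pi>, \<epsilon>) \<Rightarrow> (inv \<rho> \<circ> \<pi>, \<lambda>i. \<epsilon> (\<rho> i)) of (\<pi>, \<epsilon>) \<Rightarrow> (\<rho> \<circ> \<pi>, \<lambda>i. \<epsilon> (inv \<rho> i))) = \<sigma>"
      using permutes_inverses[OF assms] by (simp add: fun_eq_iff)
    show "(case \<sigma> of (\<pi>, \<epsilon>) \<Rightarrow> (\<rho> \<circ> \<pi>, \<lambda>i. \<epsilon> (inv \<rho> i))) \<in> W_group n"
      using W[OF inv \<sigma>] by (simp add: permutes_inv_inv[OF assms])
    show "(case \<sigma> of (\<pi>, \<epsilon>) \<Rightarrow> (inv \<rho> \<circ> \<pi>, \<lambda>i. \<epsilon> (\<rho> i))) \<in> W_group n"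
      using W[OF assms \<sigma>] by simp
    have "\<pi> permutes {1..n}"
      using \<sigma> by (simp add: W_group_def)
    then have "inv (\<rho> \<circ> \<pi>) = inv \<pi> \<circ> inv \<rho>"
      using assms by (simp add: o_inv_distrib permutes_bij)
    then show "f (\<lambda>i. W_act (case \<sigma> of (\<pi>, \<epsilon>) \<Rightarrow> (\<rho> \<circ> \<pi>, \<lambda>i. \<epsilon> (inv \<rho> i))) x (\<rho> i)) = f (W_act \<sigma> x)"
      using permutes_inverses[OF assms] by (simp add: W_act_def)
  qed
qed

text \<open>Odd exponents cancel under the sign changes, and the remaining compositions of 2m are
  twice the compositions of m.\<close>

lemma sum_W_group_power_product:
  fixes x :: "nat \<Rightarrow> real"
  shows "(\<Sum>\<sigma>\<in>W_group n. \<Sum>\<mu>\<in>weak_comps {1..n} (2 * m). \<Prod>i=1..n. W_act \<sigma> x i ^ \<mu> i / fact (\<mu> i + of_bool (i \<le> k))) =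
    2 ^ n * (\<Sum>b\<in>weak_comps {1..n} m. (\<Prod>i=1..n. 1 / fact (2 * b i + of_bool (i \<le> k))) * mono_sym n b (\<lambda>i. x i ^ 2))"
proof -
  let ?c = "\<lambda>\<mu>. \<Prod>i=1..n. 1 / fact (\<mu> i + of_bool (i \<le> k)) :: real"
  let ?E = "{\<mu> \<in> weak_comps {1..n} (2 * m). \<forall>i\<in>{1..n}. even (\<mu> i)}"
  have "(\<Sum>\<sigma>\<in>W_group n. \<Sum>\<mu>\<in>weak_comps {1..n} (2 * m). \<Prod>i=1..n. W_act \<sigma> x i ^ \<mu> i / fact (\<mu> i + of_bool (i \<le> k))) =
      (\<Sum>\<mu>\<in>weak_comps {1..n} (2 * m). ?c \<mu> * (\<Sum>\<sigma>\<in>W_group n. \<Prod>i=1..n. W_act \<sigma> x i ^ \<mu> i))"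
    by (subst sum.swap) (simp add: sum_distrib_left prod_dividef)
  also have "\<dots> = (\<Sum>\<mu>\<in>?E. ?c \<mu> * (2 ^ n * mono_sym n \<mu> x))"
    unfolding sum_W_group_monomial by (rule sum.mono_neutral_cong_right) auto
  also have "\<dots> = (\<Sum>b\<in>weak_comps {1..n} m. 2 ^ n * (?c (\<lambda>i. 2 * b i) * mono_sym n b (\<lambda>i. x i ^ 2)))"
  proof (rule sum.reindex_bij_witness[of _ "\<lambda>b. \<lambda>i\<in>{1..n}. 2 * b i" "\<lambda>\<mu>. \<lambda>i\<in>{1..n}. \<mu> i div 2"])
    fix \<mu> assume \<mu>: "\<mu> \<in> ?E"
    have h: "2 * (\<mu> i div 2) = \<mu> i" if "i \<in> {1..n}" for i
      using \<mu> that by auto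
    have ext: "\<mu> i = undefined" if "i \<notin> {1..n}" for i
      using \<mu> that by (auto simp: weak_comps_def PiE_iff extensional_def)
    show "(\<lambda>i\<in>{1..n}. 2 * (\<lambda>i\<in>{1..n}. \<mu> i div 2) i) = \<mu>"
      using h ext by (auto simp: fun_eq_iff)
    have "2 * (\<Sum>i=1..n. \<mu> i div 2) = (\<Sum>i=1..n. \<mu> i)"
      unfolding sum_distrib_left by (intro sum.cong refl h)
    then have "2 * (\<Sum>i=1..n. \<mu> i div 2) = 2 * m"
      using \<mu> by (simp add: weak_comps_def)
    then show "(\<lambda>i\<in>{1..n}. \<mu> i div 2) \<in> weak_comps {1..n} m"
      by (simp add: weak_comps_def)
    have "mono_sym n \<mu> x = mono_sym n (\<lambda>i\<in>{1..n}. \<mu> i div 2) (\<lambda>i. x i ^ 2)"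
      by (rule mono_sym_even) (simp add: h)
    moreover have "?c (\<lambda>i. 2 * (\<lambda>i\<in>{1..n}. \<mu> i div 2) i) = ?c \<mu>"
      by (intro prod.cong refl) (simp add: h)
    ultimately show "2 ^ n * (?c (\<lambda>i. 2 * (\<lambda>i\<in>{1..n}. \<mu> i div 2) i) * mono_sym n (\<lambda>i\<in>{1..n}. \<mu> i div 2) (\<lambda>i. x i ^ 2)) =
        ?c \<mu> * (2 ^ n * mono_sym n \<mu> x)"
      by simp
  next
    fix b assume b: "b \<in> weak_comps {1..n} m"
    then show "(\<lambda>i\<in>{1..n}. (\<lambda>i\<in>{1..n}. 2 * b i) i div 2) = b"
      by (auto simp: weak_comps_def PiE_iff extensional_def fun_eq_iff)
    show "(\<lambda>i\<in>{1..n}. 2 * b i) \<in> ?E"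
      using b by (auto simp: weak_comps_def sum_distrib_left[symmetric])
  qed
  finally show ?thesis
    by (simp add: sum_distrib_left)
qed

text \<open>The group sum does not change if the first k coordinates of every orbit point are
  permuted by a fixed \<rho>. Summing over all such \<rho> completes each flag to a whole face, at
  the cost of a factor 1/k!.\<close>

lemma tau_eval:
  assumes "k \<le> n" and x: "superincreasing x"
  shows "real_ev.ev x (tau n k (2 * m)) = fact (2 * m + k) / (fact k * fact n) *
    (\<Sum>b\<in>weak_comps {1..n} m. (\<Prod>i=1..n. 1 / fact (2 * b i + of_bool (i \<le> k))) * mono_sym n b (\<lambda>i. x i ^ 2))"
proof -
  define h where "h = (\<lambda>z :: nat \<Rightarrow> real. H_poly (k + 1) (2 * m) (\<lambda>i. \<Sum>l=i..n. z l))"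
  let ?R = "\<Sum>b\<in>weak_comps {1..n} m. (\<Prod>i=1..n. 1 / fact (2 * b i + of_bool (i \<le> k))) * mono_sym n b (\<lambda>i. x i ^ 2)"
  have tau: "real_ev.ev x (tau n k (2 * m)) = 1 / (2 ^ n * fact n) * (\<Sum>\<sigma>\<in>W_group n. h (W_act \<sigma> x))"
    unfolding tau_def h_def
    by (simp only: real_ev.ev_mult real_ev.ev_Const real_ev.ev_sum real_ev.ev_W_pullback real_ev.ev_h_poly)
  \<comment> \<open>A partial sum of the transformed point is a signed subset sum of x, so
    superincreasing x meets the hypothesis of \<open>sum_h_permutations\<close> for every
    \<sigma>.\<close>
  have nz: "sum (W_act \<sigma> x) S \<noteq> 0" if "\<sigma> \<in> W_group n" "S \<subseteq> {1..k}" "S \<noteq> {}" for \<sigma> S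
  proof -
    define \<pi> \<epsilon> where "\<pi> = fst \<sigma>" and "\<epsilon> = snd \<sigma>"
    then have \<sigma>: "\<sigma> = (\<pi>, \<epsilon>)" and \<pi>: "\<pi> permutes {1..n}" and \<epsilon>: "\<epsilon> \<in> {1..n} \<rightarrow>\<^sub>E {1, -1}"
      using that by (simp_all add: W_group_def mem_Times_iff)
    have inj: "inj_on (inv \<pi>) S"
      using permutes_inj[OF permutes_inv[OF \<pi>]] by (auto intro: inj_on_subset)
    have "sum (W_act \<sigma> x) S = (\<Sum>j\<in>inv \<pi> ` S. of_int (\<epsilon> (\<pi> j)) * x j)"
      unfolding sum.reindex[OF inj] using permutes_inverses[OF \<pi>] by (simp add: \<sigma> W_act_def)
    also have "\<dots> \<noteq> 0"
    proof (rule superincreasing_signed_sum_nonzero[OF x])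
      fix j assume "j \<in> inv \<pi> ` S"
      then have "\<pi> j \<in> {1..n}"
        using that(2) assms(1) permutes_inverses[OF \<pi>] by auto
      then have "\<epsilon> (\<pi> j) \<in> {1, -1}"
        by (rule PiE_mem[OF \<epsilon>])
      then show "\<bar>real_of_int (\<epsilon> (\<pi> j))\<bar> = 1"
        by auto
    qed (use that finite_subset[OF that(2)] in auto)
    finally show ?thesis .
  qed
  have "fact k * (\<Sum>\<sigma>\<in>W_group n. h (W_act \<sigma> x)) =
      (\<Sum>\<rho> | \<rho> permutes {1..k}. \<Sum>\<sigma>\<in>W_group n. h (W_act \<sigma> x))"
    using card_permutations[of "{1..k}" k] by simp
  also have "\<dots> = (\<Sum>\<rho> | \<rho> permutes {1..k}. \<Sum>\<sigma>\<in>W_group n. h (\<lambda>i. W_act \<sigma> x (\<rho> i)))"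
  proof (rule sum.cong[OF refl])
    fix \<rho> assume "\<rho> \<in> {\<rho>. \<rho> permutes {1..k}}"
    then have "\<rho> permutes {1..n}"
      using assms(1) by (auto intro: permutes_subset)
    then show "(\<Sum>\<sigma>\<in>W_group n. h (W_act \<sigma> x)) = (\<Sum>\<sigma>\<in>W_group n. h (\<lambda>i. W_act \<sigma> x (\<rho> i)))"
      by (rule sum_W_group_compose)
  qed
  also have "\<dots> = (\<Sum>\<sigma>\<in>W_group n. \<Sum>\<rho> | \<rho> permutes {1..k}. h (\<lambda>i. W_act \<sigma> x (\<rho> i)))"
    by (rule sum.swap)
  also have "\<dots> = (\<Sum>\<sigma>\<in>W_group n. fact (2 * m + k) *
      (\<Sum>\<mu>\<in>weak_comps {1..n} (2 * m). \<Prod>i=1..n. W_act \<sigma> x i ^ \<mu> i / fact (\<mu> i + of_bool (i \<le> k))))"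
    unfolding h_def by (rule sum.cong[OF refl], rule sum_h_permutations[OF assms(1) nz])
  also have "\<dots> = fact (2 * m + k) * (2 ^ n * ?R)"
    unfolding sum_distrib_left[symmetric] sum_W_group_power_product ..
  finally have "(\<Sum>\<sigma>\<in>W_group n. h (W_act \<sigma> x)) = fact (2 * m + k) * (2 ^ n * ?R) / fact k"
    by (simp add: field_simps)
  then show ?thesis
    unfolding tau by simp
qed

lemma tau_eq:
  assumes "k \<le> n"
  shows "tau n k (2 * m) = (\<Sum>b\<in>weak_comps {1..n} m.
    Const (fact (2 * m + k) / (fact k * fact n) * (\<Prod>i=1..n. 1 / fact (2 * b i + of_bool (i \<le> k)))) *
    mono_sym n b sq_var)"
proof (rule rpoly_eqI)
  fix x assume x: "superincreasing x"
  have "real_ev.ev x (mono_sym n b sq_var) = mono_sym n b (\<lambda>i. x i ^ 2)" for b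
    by (simp add: mono_sym_def real_ev.ev_sum real_ev.ev_prod real_ev.ev_power sq_var_def)
  then show "real_ev.ev x (tau n k (2 * m)) = real_ev.ev x (\<Sum>b\<in>weak_comps {1..n} m.
    Const (fact (2 * m + k) / (fact k * fact n) * (\<Prod>i=1..n. 1 / fact (2 * b i + of_bool (i \<le> k)))) *
    mono_sym n b sq_var)"
    unfolding tau_eval[OF assms x]
    by (simp only: real_ev.ev_sum real_ev.ev_mult real_ev.ev_Const sum_distrib_left mult.assoc)
qed

section \<open>The basis theorem\<close>

text \<open>A general set K replaces \<open>{1..k}\<close>, so that the sum over all K with k
  elements is the coefficient of u^k in an expression in the face series.\<close>

definition face_weight_sum :: "nat \<Rightarrow> nat \<Rightarrow> nat set \<Rightarrow> real"
  where "face_weight_sum n m K = (\<Sum>b\<in>weak_comps {1..n} m.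
    (\<Prod>i=1..n. 1 / fact (2 * b i + of_bool (i \<in> K))) * power_sum_weight n (card (supp n b)))"

lemma ex_permutes_image:
  assumes "finite A" "K \<subseteq> A" "K' \<subseteq> A" "card K = card K'"
  shows "\<exists>\<pi>. \<pi> permutes A \<and> (\<forall>i\<in>A. \<pi> i \<in> K' \<longleftrightarrow> i \<in> K)"
proof -
  have fin: "finite K" "finite K'"
    using assms finite_subset by auto
  obtain f where f: "bij_betw f K K'"
    using finite_same_card_bij[OF fin assms(4)] by blast
  have "card (A - K) = card (A - K')"
    using assms fin by (simp add: card_Diff_subset)
  then obtain g where g: "bij_betw g (A - K) (A - K')"
    using finite_same_card_bij[of "A - K" "A - K'"] assms(1) by auto
  define \<pi> where "\<pi> = (\<lambda>i. if i \<in> K then f i else if i \<in> A then g i else i)"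
  have fK: "bij_betw \<pi> K K'"
    using f by (rule bij_betw_cong[THEN iffD1, rotated]) (simp add: \<pi>_def)
  have gK: "bij_betw \<pi> (A - K) (A - K')"
    using g by (rule bij_betw_cong[THEN iffD1, rotated]) (simp add: \<pi>_def)
  have "bij_betw \<pi> (K \<union> (A - K)) (K' \<union> (A - K'))"
    by (rule bij_betw_combine[OF fK gK]) auto
  moreover have "K \<union> (A - K) = A" "K' \<union> (A - K') = A"
    using assms by auto
  ultimately have "\<pi> permutes A"
    using assms(2) by (intro bij_imp_permutes) (auto simp: \<pi>_def)
  moreover have "\<pi> i \<in> K' \<longleftrightarrow> i \<in> K" if "i \<in> A" for i
    using that bij_betwE[OF fK] bij_betwE[OF gK] by auto
  ultimately show ?thesis
    by blast
qed

lemma face_weight_sum_card: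
  assumes "K \<subseteq> {1..n}" "K' \<subseteq> {1..n}" "card K = card K'"
  shows "face_weight_sum n m K = face_weight_sum n m K'"
proof -
  obtain \<pi> where \<pi>: "\<pi> permutes {1..n}" and K: "\<And>i. i \<in> {1..n} \<Longrightarrow> \<pi> i \<in> K' \<longleftrightarrow> i \<in> K"
    using ex_permutes_image[OF finite_atLeastAtMost assms] by blast
  have comp: "(\<lambda>i. b (\<tau> i)) \<in> weak_comps {1..n} m" if b: "b \<in> weak_comps {1..n} m" and \<tau>: "\<tau> permutes {1..n}" for b \<tau>
  proof -
    have "(\<Sum>i=1..n. b (\<tau> i)) = sum b {1..n}"
      using sum.permute[OF \<tau>, of b] by (simp add: comp_def)
    moreover have "(\<lambda>i. b (\<tau> i)) \<in> extensional {1..n}"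
      using b permutes_not_in[OF \<tau>] by (auto simp: weak_comps_def PiE_iff extensional_def)
    ultimately show ?thesis
      using b by (simp add: weak_comps_def PiE_iff)
  qed
  show ?thesis
    unfolding face_weight_sum_def
  proof (rule sum.reindex_bij_witness[of _ "\<lambda>b i. b (\<pi> i)" "\<lambda>b i. b (inv \<pi> i)"])
    fix b assume b: "b \<in> weak_comps {1..n} m"
    show "(\<lambda>i. b (inv \<pi> i)) \<in> weak_comps {1..n} m" "(\<lambda>i. b (\<pi> i)) \<in> weak_comps {1..n} m"
      using comp[OF b] \<pi> permutes_inv[OF \<pi>] by auto
    have "(\<Prod>i=1..n. 1 / fact (2 * b (inv \<pi> i) + of_bool (i \<in> K'))) =
        (\<Prod>i=1..n. 1 / fact (2 * b (inv \<pi> (\<pi> i)) + of_bool (\<pi> i \<in> K')) :: real)"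
      using prod.permute[OF \<pi>, of "\<lambda>i. 1 / fact (2 * b (inv \<pi> i) + of_bool (i \<in> K')) :: real"]
      by (simp only: comp_def)
    also have "\<dots> = (\<Prod>i=1..n. 1 / fact (2 * b i + of_bool (i \<in> K)))"
      by (intro prod.cong refl) (simp only: K permutes_inverses[OF \<pi>])
    finally have p: "(\<Prod>i=1..n. 1 / fact (2 * b (inv \<pi> i) + of_bool (i \<in> K'))) =
        (\<Prod>i=1..n. 1 / fact (2 * b i + of_bool (i \<in> K)) :: real)" .
    have "supp n (\<lambda>i. b (inv \<pi> i)) = \<pi> ` supp n b"
    proof (intro equalityI subsetI)
      fix i assume "i \<in> supp n (\<lambda>i. b (inv \<pi> i))"
      then have "inv \<pi> i \<in> supp n b"
        using permutes_in_image[OF permutes_inv[OF \<pi>], of i] by simp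
      then have "\<pi> (inv \<pi> i) \<in> \<pi> ` supp n b"
        by (rule imageI)
      then show "i \<in> \<pi> ` supp n b"
        by (simp only: permutes_inverses[OF \<pi>])
    next
      fix i assume "i \<in> \<pi> ` supp n b"
      then show "i \<in> supp n (\<lambda>i. b (inv \<pi> i))"
        using permutes_in_image[OF \<pi>] permutes_inverses[OF \<pi>] by auto
    qed
    then have "card (supp n (\<lambda>i. b (inv \<pi> i))) = card (supp n b)"
      using permutes_inj[OF \<pi>] by (simp only:) (intro card_image, auto intro: inj_on_subset)
    then show "(\<Prod>i=1..n. 1 / fact (2 * b (inv \<pi> i) + of_bool (i \<in> K'))) * power_sum_weight n (card (supp n (\<lambda>i. b (inv \<pi> i)))) =
        (\<Prod>i=1..n. 1 / fact (2 * b i + of_bool (i \<in> K))) * power_sum_weight n (card (supp n b))"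
      by (simp only: p)
  qed (simp_all add: permutes_inverses[OF \<pi>])
qed

text \<open>Grouping the compositions by their support B turns the sum into powers of the series
  without constant term.\<close>

lemma sum_weak_comps_by_support:
  "(\<Sum>b\<in>weak_comps {1..n} m. [:power_sum_weight n (card (supp n b)):] * (\<Prod>i=1..n. fps_nth face_series (b i))) =
    (\<Sum>s=0..n. of_nat (n choose s) * ([:power_sum_weight n s:] *
      (one_u ^ (n - s) * fps_nth ((face_series - fps_const one_u) ^ s) m)))"
proof -
  let ?Y = "face_series - fps_const one_u"
  let ?w = "\<lambda>s. [:power_sum_weight n s:]"
  let ?t = "\<lambda>s. ?w s * (one_u ^ (n - s) * fps_nth (?Y ^ s) m)"
  have f0: "fps_nth face_series 0 = one_u"
    by (simp add: face_series_def one_u_def)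
  \<comment> \<open>The constant factor survives only where b i = 0 and \<open>?Y\<close> only where
    b i \<noteq> 0, so the product for B selects the compositions with support B.\<close>
  have factors: "(\<Prod>i=1..n. fps_nth (if i \<in> B then ?Y else fps_const one_u) (b i)) =
      (if supp n b = B then \<Prod>i=1..n. fps_nth face_series (b i) else 0)" if B: "B \<in> Pow {1..n}" for b B
  proof (cases "supp n b = B")
    case True
    then have BI: "b i \<noteq> 0 \<longleftrightarrow> i \<in> B" if "i \<in> {1..n}" for i
      using that by auto
    have "(\<Prod>i=1..n. fps_nth (if i \<in> B then ?Y else fps_const one_u) (b i)) =
        (\<Prod>i=1..n. fps_nth face_series (b i))"
    proof (rule prod.cong[OF refl])
      fix i assume "i \<in> {1..n}"
      then show "fps_nth (if i \<in> B then ?Y else fps_const one_u) (b i) = fps_nth face_series (b i)"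
        using BI[of i] f0 by (cases "b i = 0") simp_all
    qed
    then show ?thesis
      using True by simp
  next
    case False
    have "supp n b = B" if "\<forall>i\<in>{1..n}. b i \<noteq> 0 \<longleftrightarrow> i \<in> B"
      using that B unfolding Pow_iff by blast
    then obtain i where i: "i \<in> {1..n}" "(b i \<noteq> 0) \<noteq> (i \<in> B)"
      using False by blast
    then have "(\<Prod>i=1..n. fps_nth (if i \<in> B then ?Y else fps_const one_u) (b i)) = 0"
      by (intro prod_zero bexI[of _ i]) (auto simp: f0)
    then show ?thesis
      using False by simp
  qed
  have prodB: "fps_nth (\<Prod>i=1..n. if i \<in> B then ?Y else fps_const one_u) m =
      one_u ^ (n - card B) * fps_nth (?Y ^ card B) m" if B: "B \<in> Pow {1..n}" for B
  proof -
    have fin: "finite B"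
      using B finite_subset by auto
    have "(\<Prod>i=1..n. if i \<in> B then ?Y else fps_const one_u) =
        (\<Prod>i\<in>B. ?Y) * (\<Prod>i\<in>{1..n} - B. fps_const one_u)"
      using B by (subst prod.If_cases) (auto simp: Int_absorb1 Diff_eq)
    also have "\<dots> = fps_const (one_u ^ (n - card B)) * ?Y ^ card B"
      using B fin by (simp add: card_Diff_subset fps_const_power mult.commute)
    finally show ?thesis
      by simp
  qed
  have "(\<Sum>b\<in>weak_comps {1..n} m. ?w (card (supp n b)) * (\<Prod>i=1..n. fps_nth face_series (b i))) =
      (\<Sum>b\<in>weak_comps {1..n} m. \<Sum>B\<in>Pow {1..n}. ?w (card B) *
        (if supp n b = B then \<Prod>i=1..n. fps_nth face_series (b i) else 0))"
  proof (rule sum.cong[OF refl])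
    fix b
    have "(\<Sum>B\<in>Pow {1..n}. ?w (card B) * (if supp n b = B then \<Prod>i=1..n. fps_nth face_series (b i) else 0)) =
        (\<Sum>B\<in>Pow {1..n}. if supp n b = B then ?w (card B) * (\<Prod>i=1..n. fps_nth face_series (b i)) else 0)"
      by (intro sum.cong refl) (simp only: mult_zero_right if_distrib[of "(*) _"])
    also have "\<dots> = ?w (card (supp n b)) * (\<Prod>i=1..n. fps_nth face_series (b i))"
      by (subst sum.delta') auto
    finally show "?w (card (supp n b)) * (\<Prod>i=1..n. fps_nth face_series (b i)) =
        (\<Sum>B\<in>Pow {1..n}. ?w (card B) * (if supp n b = B then \<Prod>i=1..n. fps_nth face_series (b i) else 0))"
      by (rule sym)
  qed
  also have "\<dots> = (\<Sum>B\<in>Pow {1..n}. ?w (card B) * fps_nth (\<Prod>i=1..n. if i \<in> B then ?Y else fps_const one_u) m)"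
    unfolding fps_prod_nth_weak_comps[OF finite_atLeastAtMost] sum_distrib_left
    by (subst sum.swap) (intro sum.cong refl, simp only: factors)
  also have "\<dots> = (\<Sum>B\<in>Pow {1..n}. ?t (card B))"
    by (intro sum.cong refl) (simp only: prodB)
  also have "\<dots> = (\<Sum>s=0..n. \<Sum>B | B \<in> Pow {1..n} \<and> card B = s. ?t (card B))"
    by (rule sum.group[symmetric]) (auto dest!: card_mono[rotated])
  also have "\<dots> = (\<Sum>s=0..n. of_nat (n choose s) * ?t s)"
    using n_subsets[of "{1..n}"] by (intro sum.cong refl) simp
  finally show ?thesis .
qed

text \<open>Each factor has the form 1/(2b)! + u/(2b + 1)!, so the coefficient of u^k collects the
  sets K of size k. By symmetry they contribute equally, and the coefficient is a multiple of the
  sum in question, yet nonzero.\<close>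

lemma face_weight_sum_nonzero:
  assumes "1 \<le> m" "m \<le> n" "k \<le> n"
  shows "face_weight_sum n m {1..k} \<noteq> 0"
proof -
  let ?c = "\<lambda>b. power_sum_weight n (card (supp n b))"
  let ?p = "\<lambda>b K. \<Prod>i=1..n. 1 / fact (2 * b i + of_bool (i \<in> K)) :: real"
  have prod: "(\<Prod>i=1..n. fps_nth face_series (b i)) = (\<Sum>K\<in>Pow {1..n}. monom (?p b K) (card K))" for b
  proof -
    have m: "(\<Prod>i\<in>K. monom (a i) 1) = monom (\<Prod>i\<in>K. a i) (card K)" if "finite K" for K and a :: "nat \<Rightarrow> real"
      using that by (induction K) (simp_all add: mult_monom)
    have m0: "(\<Prod>i\<in>K. monom (a i) 0) = monom (\<Prod>i\<in>K. a i) 0" if "finite K" for K and a :: "nat \<Rightarrow> real"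
      using that by (induction K) (simp_all add: mult_monom)
    have "(\<Prod>i=1..n. fps_nth face_series (b i)) =
        (\<Prod>i=1..n. monom (1 / fact (2 * b i + 1)) 1 + monom (1 / fact (2 * b i)) 0)"
      by (intro prod.cong refl) (simp add: face_series_def monom_altdef del: fact_Suc)
    also have "\<dots> = (\<Sum>K\<in>Pow {1..n}. (\<Prod>i\<in>K. monom (1 / fact (2 * b i + 1)) 1) *
        (\<Prod>i\<in>{1..n} - K. monom (1 / fact (2 * b i)) 0))"
      by (rule prod_add) simp
    also have "\<dots> = (\<Sum>K\<in>Pow {1..n}. monom (?p b K) (card K))"
    proof (rule sum.cong[OF refl])
      fix K assume K: "K \<in> Pow {1..n}"
      then have fin: "finite K"
        using finite_subset by auto
      have "?p b K = (\<Prod>i\<in>{1..n} - K. 1 / fact (2 * b i + of_bool (i \<in> K))) * (\<Prod>i\<in>K. 1 / fact (2 * b i + of_bool (i \<in> K)))"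
        using K by (intro prod.subset_diff) auto
      also have "\<dots> = (\<Prod>i\<in>{1..n} - K. 1 / fact (2 * b i)) * (\<Prod>i\<in>K. 1 / fact (2 * b i + 1))"
        by (intro arg_cong2[where f = "(*)"] prod.cong) auto
      finally have p: "?p b K = (\<Prod>i\<in>{1..n} - K. 1 / fact (2 * b i)) * (\<Prod>i\<in>K. 1 / fact (2 * b i + 1))" .
      show "(\<Prod>i\<in>K. monom (1 / fact (2 * b i + 1)) 1) * (\<Prod>i\<in>{1..n} - K. monom (1 / fact (2 * b i)) 0) =
          monom (?p b K) (card K)"
        unfolding p m[OF fin] m0[OF finite_Diff[OF finite_atLeastAtMost]] mult_monom
        by (simp only: add_0_right mult.commute)
    qed
    finally show ?thesis .
  qed
  have "coeff (\<Sum>b\<in>weak_comps {1..n} m. [:?c b:] * (\<Prod>i=1..n. fps_nth face_series (b i))) k =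
      (\<Sum>b\<in>weak_comps {1..n} m. \<Sum>K\<in>Pow {1..n}. if card K = k then ?p b K * ?c b else 0)"
    unfolding prod coeff_sum
    by (intro sum.cong refl) (simp add: coeff_sum sum_distrib_left mult.commute if_distrib cong: if_cong)
  also have "\<dots> = (\<Sum>K\<in>Pow {1..n}. if card K = k then face_weight_sum n m K else 0)"
    by (subst sum.swap) (auto intro!: sum.cong simp: face_weight_sum_def)
  also have "\<dots> = (\<Sum>K\<in>Pow {1..n}. if card K = k then face_weight_sum n m {1..k} else 0)"
    using assms(3) by (intro sum.cong refl) (auto intro!: face_weight_sum_card)
  also have "\<dots> = (\<Sum>K\<in>Pow {1..n}. of_bool (card K = k)) * face_weight_sum n m {1..k}"
    unfolding sum_distrib_right by (intro sum.cong refl) auto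
  finally show ?thesis
    using face_coefficient_nonzero[OF assms] unfolding sum_weak_comps_by_support by auto
qed

text \<open>\<open>homogeneous\<close> hides the degree and is not stable under sums. With the
  degree fixed it is, the zero polynomial having every degree.\<close>

definition hom_degree :: "nat \<Rightarrow> rpoly \<Rightarrow> bool"
  where "hom_degree d p \<longleftrightarrow> (\<forall>m\<in>Poly_Mapping.keys p. monom_degree m = d)"

lemma monom_degree_add: "monom_degree (a + b) = monom_degree a + monom_degree b"
proof -
  have s: "monom_degree m = (\<Sum>i\<in>S. Poly_Mapping.lookup m i)" if "finite S" "Poly_Mapping.keys m \<subseteq> S" for m S
    unfolding monom_degree_def using that by (intro sum.mono_neutral_left) (auto simp: in_keys_iff)
  let ?S = "Poly_Mapping.keys a \<union> Poly_Mapping.keys b"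
  have "Poly_Mapping.keys (a + b) \<subseteq> ?S"
    by (rule keys_add)
  then show ?thesis
    by (simp add: s[of ?S] lookup_add sum.distrib)
qed

lemma hom_degree_Const: "hom_degree 0 (Const a)"
  by (cases "a = 0") (simp_all add: hom_degree_def Const_def monom_degree_def)

lemma hom_degree_Var: "hom_degree 1 (Var i)"
  by (simp add: hom_degree_def Var_def monom_degree_def)

lemma hom_degree_add: "hom_degree d p \<Longrightarrow> hom_degree d q \<Longrightarrow> hom_degree d (p + q)"
  using keys_add[of p q] by (auto simp: hom_degree_def)

lemma hom_degree_mult: "hom_degree d p \<Longrightarrow> hom_degree e q \<Longrightarrow> hom_degree (d + e) (p * q)"
  using keys_mult[of p q] by (fastforce simp: hom_degree_def monom_degree_add)

lemma hom_degree_0: "hom_degree d 0"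
  by (simp add: hom_degree_def)

lemma hom_degree_sum: "(\<And>i. i \<in> A \<Longrightarrow> hom_degree d (f i)) \<Longrightarrow> hom_degree d (\<Sum>i\<in>A. f i)"
  using hom_degree_0 by (induction A rule: infinite_finite_induct) (auto intro: hom_degree_add)

lemma hom_degree_power: "hom_degree d p \<Longrightarrow> hom_degree (d * k) (p ^ k)"
  using hom_degree_Const[of 1] by (induction k) (auto intro: hom_degree_mult)

lemma hom_degree_prod: "(\<And>i. i \<in> A \<Longrightarrow> hom_degree (d i) (f i)) \<Longrightarrow> hom_degree (sum d A) (\<Prod>i\<in>A. f i)"
  using hom_degree_Const[of 1] by (induction A rule: infinite_finite_induct) (auto intro: hom_degree_mult)

lemma hom_degree_mono_sym: "hom_degree (2 * sum b {1..n}) (mono_sym n b sq_var)"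
  unfolding mono_sym_def sum_distrib_left sq_var_def
  using hom_degree_power[OF hom_degree_power[OF hom_degree_Var]]
  by (intro hom_degree_sum hom_degree_prod) simp

lemma homogeneous_tau:
  assumes "k \<le> n"
  shows "homogeneous (tau n k (2 * m))"
proof -
  have "hom_degree (0 + 2 * m) (tau n k (2 * m))"
    unfolding tau_eq[OF assms]
  proof (intro hom_degree_sum hom_degree_mult hom_degree_Const)
    fix b assume "b \<in> weak_comps {1..n} m"
    then show "hom_degree (2 * m) (mono_sym n b sq_var)"
      using hom_degree_mono_sym[of b n] by (simp add: weak_comps_def)
  qed
  then show ?thesis
    by (auto simp: homogeneous_def hom_degree_def)
qed

section \<open>Triangular changes of generators\<close>

definition triangular :: "nat \<Rightarrow> (nat \<Rightarrow> rpoly) \<Rightarrow> (nat \<Rightarrow> rpoly) \<Rightarrow> bool"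
  where "triangular n f g \<longleftrightarrow> (\<forall>i\<in>{1..n}. \<exists>c D. c \<noteq> 0 \<and> D \<in> generated_algebra (f ` {1..<i}) \<and> g i = Const c * f i + D)"

lemma triangular_tau:
  assumes "k \<le> n"
  shows "triangular n (sq_power_sum n) (\<lambda>i. tau n k (2 * i))"
  unfolding triangular_def
proof
  fix m assume m: "m \<in> {1..n}"
  let ?K = "fact (2 * m + k) / (fact k * fact n) :: real"
  let ?a = "\<lambda>b. ?K * (\<Prod>i=1..n. 1 / fact (2 * b i + of_bool (i \<le> k)))"
  have "\<exists>D\<in>lower_algebra n m. tau n k (2 * m) =
      Const (\<Sum>b\<in>weak_comps {1..n} m. ?a b * power_sum_weight n (card (supp n b))) * sq_power_sum n m + D"
    unfolding tau_eq[OF assms]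
    by (rule mono_sym_combination[OF finite_weak_comps[OF finite_atLeastAtMost]]) (use m in \<open>auto simp: weak_comps_def\<close>)
  moreover have eq: "(\<Sum>b\<in>weak_comps {1..n} m. ?a b * power_sum_weight n (card (supp n b))) =
      ?K * face_weight_sum n m {1..k}"
    unfolding face_weight_sum_def sum_distrib_left mult.assoc
    by (intro sum.cong arg_cong2[where f = "(*)"] prod.cong refl) auto
  moreover have "?K * face_weight_sum n m {1..k} \<noteq> 0"
    using face_weight_sum_nonzero[of m n k] m assms by simp
  ultimately show "\<exists>c D. c \<noteq> 0 \<and> D \<in> lower_algebra n m \<and> tau n k (2 * m) = Const c * sq_power_sum n m + D"
    unfolding eq by blast
qed

lemma triangular_elem_sym: "triangular n (sq_power_sum n) (\<lambda>i. elem_sym n i sq_var)"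
  unfolding triangular_def using elem_sym_reduction by (metis atLeastAtMost_iff)

text \<open>Since the leading constant is invertible, \<open>f i\<close> is recovered from
  \<open>g i\<close> as soon as the earlier members of f have been generated.\<close>

lemma triangular_generates:
  assumes "triangular n f g" "i \<in> {1..n}"
  shows "f i \<in> generated_algebra (g ` {1..n})"
  using assms(2)
proof (induction i rule: less_induct)
  case (less i)
  obtain c D where c: "c \<noteq> 0" and D: "D \<in> generated_algebra (f ` {1..<i})" and g: "g i = Const c * f i + D"
    using assms(1) less.prems unfolding triangular_def by blast
  have "f ` {1..<i} \<subseteq> generated_algebra (g ` {1..n})"
    using less by auto
  then have "D \<in> generated_algebra (g ` {1..n})"
    using D generated_algebra_mono by blast
  moreover have "g i \<in> generated_algebra (g ` {1..n})"
    using less.prems by (intro generated_algebra.gen imageI)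
  ultimately have "Const (1 / c) * (g i - D) \<in> generated_algebra (g ` {1..n})"
    by (intro generated_algebra.mult generated_algebra.Const generated_algebra_diff)
  also have "Const (1 / c) * (g i - D) = Const (1 / c * c) * f i"
    unfolding g Const_mult by (simp add: mult.assoc)
  finally show ?case
    using c by simp
qed

lemma triangularE:
  assumes "triangular n f g"
  obtains c q where "\<And>i. i \<in> {1..n} \<Longrightarrow> c i \<noteq> 0" "\<And>i. i \<in> {1..n} \<Longrightarrow> vars (q i) \<subseteq> {1..<i}"
    "\<And>i x. i \<in> {1..n} \<Longrightarrow> complex_ev.ev x (g i) =
      of_real (c i) * complex_ev.ev x (f i) + complex_ev.ev (\<lambda>j. complex_ev.ev x (f j)) (q i)"
proof -
  have "\<forall>i\<in>{1..n}. \<exists>c q. c \<noteq> 0 \<and> vars q \<subseteq> {1..<i} \<and> g i = Const c * f i + subst f q"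
    using assms generated_algebra_eq_subst unfolding triangular_def by metis
  then obtain c q where cq: "\<forall>i\<in>{1..n}. c i \<noteq> 0 \<and> vars (q i) \<subseteq> {1..<i} \<and> g i = Const (c i) * f i + subst f (q i)"
    by metis
  show ?thesis
    by (rule that[of c q]) (use cq in \<open>auto simp: complex_ev.ev_add complex_ev.ev_mult complex_ev.ev_subst\<close>)
qed

text \<open>Values w wanted for g are converted into values v for f one index at a time, dividing by
  the leading constants. The existence of a point x is a separate matter, settled through
  \<open>elem_sym_surj\<close>.\<close>

lemma triangular_values:
  assumes "triangular n f g"
  shows "\<exists>v. \<forall>x. (\<forall>i\<in>{1..n}. complex_ev.ev x (f i) = v i) \<longrightarrow> (\<forall>i\<in>{1..n}. complex_ev.ev x (g i) = w i)"
proof -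
  obtain c q where cq: "\<And>i. i \<in> {1..n} \<Longrightarrow> c i \<noteq> 0" "\<And>i. i \<in> {1..n} \<Longrightarrow> vars (q i) \<subseteq> {1..<i}"
    "\<And>i x. i \<in> {1..n} \<Longrightarrow> complex_ev.ev x (g i) =
      of_real (c i) * complex_ev.ev x (f i) + complex_ev.ev (\<lambda>j. complex_ev.ev x (f j)) (q i)"
    using triangularE[OF assms] by blast
  have "\<exists>v. \<forall>i\<in>{1..l}. of_real (c i) * v i + complex_ev.ev v (q i) = w i" if "l \<le> n" for l
    using that
  proof (induction l)
    case (Suc l)
    then obtain v where v: "\<forall>i\<in>{1..l}. of_real (c i) * v i + complex_ev.ev v (q i) = w i"
      by auto
    \<comment> \<open>Changing the value at \<open>Suc l\<close> leaves the earlier equations intact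
      because \<open>q i\<close> involves only variables below i.\<close>
    define v' where "v' = v(Suc l := (w (Suc l) - complex_ev.ev v (q (Suc l))) / of_real (c (Suc l)))"
    have ev: "complex_ev.ev v' (q i) = complex_ev.ev v (q i)" if "i \<in> {1..Suc l}" for i
      by (rule complex_ev.ev_cong) (use cq(2)[of i] that Suc.prems in \<open>force simp: v'_def\<close>)
    have "of_real (c i) * v' i + complex_ev.ev v' (q i) = w i" if "i \<in> {1..Suc l}" for i
      using that v cq(1)[of "Suc l"] Suc.prems unfolding ev[OF that]
      by (cases "i = Suc l") (simp_all add: v'_def)
    then show ?case
      by blast
  qed simp
  then obtain v where v: "\<And>i. i \<in> {1..n} \<Longrightarrow> of_real (c i) * v i + complex_ev.ev v (q i) = w i"
    by blast
  have "complex_ev.ev x (g i) = w i" if x: "\<forall>i\<in>{1..n}. complex_ev.ev x (f i) = v i" and i: "i \<in> {1..n}" for x i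
  proof -
    have "complex_ev.ev (\<lambda>j. complex_ev.ev x (f j)) (q i) = complex_ev.ev v (q i)"
      by (rule complex_ev.ev_cong) (use cq(2)[OF i] x i in force)
    then show ?thesis
      using cq(3)[OF i] v[OF i] x i by simp
  qed
  then show ?thesis
    by blast
qed

text \<open>Here w is given by a formula and induction recovers the values of f. With the elementary
  symmetric polynomials as g, this provides the values they must take for the power sums to be as
  prescribed.\<close>

lemma triangular_values_converse:
  assumes "triangular n f g"
  shows "\<exists>w. \<forall>x. (\<forall>i\<in>{1..n}. complex_ev.ev x (g i) = w i) \<longrightarrow> (\<forall>i\<in>{1..n}. complex_ev.ev x (f i) = v i)"
proof -
  obtain c q where cq: "\<And>i. i \<in> {1..n} \<Longrightarrow> c i \<noteq> 0" "\<And>i. i \<in> {1..n} \<Longrightarrow> vars (q i) \<subseteq> {1..<i}"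
    "\<And>i x. i \<in> {1..n} \<Longrightarrow> complex_ev.ev x (g i) =
      of_real (c i) * complex_ev.ev x (f i) + complex_ev.ev (\<lambda>j. complex_ev.ev x (f j)) (q i)"
    using triangularE[OF assms] by blast
  define w where "w = (\<lambda>i. of_real (c i) * v i + complex_ev.ev v (q i))"
  have "complex_ev.ev x (f i) = v i" if x: "\<forall>i\<in>{1..n}. complex_ev.ev x (g i) = w i" and i: "i \<in> {1..n}" for x i
    using i
  proof (induction i rule: less_induct)
    case (less i)
    have "complex_ev.ev (\<lambda>j. complex_ev.ev x (f j)) (q i) = complex_ev.ev v (q i)"
      by (rule complex_ev.ev_cong) (use cq(2)[OF less.prems] less in force)
    then have "of_real (c i) * complex_ev.ev x (f i) = of_real (c i) * v i"
      using cq(3)[OF less.prems, of x] bspec[OF x less.prems] by (auto simp: w_def)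
    then show ?case
      using cq(1)[OF less.prems] by simp
  qed
  then show ?thesis
    by blast
qed

section \<open>Prescribed values over the complex numbers\<close>

lemma elem_sym_surj:
  fixes e :: "nat \<Rightarrow> complex"
  shows "\<exists>y. \<forall>i\<in>{1..n}. elem_sym n i y = e i"
proof -
  \<comment> \<open>The entry 1 at index 0 makes the polynomial monic of degree n.\<close>
  define a where "a = e(0 := 1)"
  define p where "p = (\<Sum>i=0..n. monom (a i) (n - i))"
  have coeff_p: "coeff (\<Sum>i=0..n. monom (b i) (n - i)) (n - j) = b j" if "j \<le> n" for b :: "nat \<Rightarrow> complex" and j
  proof -
    have "coeff (\<Sum>i=0..n. monom (b i) (n - i)) (n - j) = (\<Sum>i=0..n. if i = j then b i else 0)"
      unfolding coeff_sum coeff_monom using that by (intro sum.cong refl) auto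
    then show ?thesis
      using that by simp
  qed
  have "coeff p n = 1"
    using coeff_p[of 0 a] by (simp add: p_def a_def)
  moreover have "degree p \<le> n"
    unfolding p_def by (intro degree_sum_le) (auto intro: order.trans[OF degree_monom_le])
  ultimately have deg: "degree p = n" and lc: "lead_coeff p = 1"
    using le_degree[of p n] by auto
  obtain root where root: "smult (lead_coeff p) (\<Prod>i<degree p. [:- root i, 1:]) = p"
    by (rule complex_poly_decompose')
  \<comment> \<open>The minus sign matches the factors t + y_j, and the shift turns the root indices
    0, ..., n - 1 into 1, ..., n.\<close>
  define y where "y = (\<lambda>i. - root (i - 1))"
  have "poly (\<Sum>i=0..n. monom (elem_sym n i y) (n - i)) t = poly p t" for t
  proof -
    have "poly (\<Sum>i=0..n. monom (elem_sym n i y) (n - i)) t = (\<Prod>j=1..n. t + y j)"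
      unfolding prod_add_elem_sym by (simp add: poly_sum poly_monom)
    also have "\<dots> = (\<Prod>i<n. t - root i)"
      by (rule prod.reindex_bij_witness[of _ Suc "\<lambda>i. i - 1"]) (auto simp: y_def)
    also have "\<dots> = poly p t"
      by (subst root[symmetric]) (simp add: lc[unfolded deg] deg poly_prod)
    finally show ?thesis .
  qed
  then have eq: "(\<Sum>i=0..n. monom (elem_sym n i y) (n - i)) = p"
    by (simp add: poly_eq_poly_eq_iff[symmetric] fun_eq_iff)
  have "elem_sym n i y = e i" if "i \<in> {1..n}" for i
    using coeff_p[of i "\<lambda>i. elem_sym n i y"] coeff_p[of i a] that unfolding eq by (simp add: p_def a_def)
  then show ?thesis
    by blast
qed

text \<open>The wanted values are traced back through the power sums to the elementary symmetric
  polynomials of some y, and complex square roots provide x with x_i^2 = y_i.\<close>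

lemma triangular_surj:
  assumes "triangular n (sq_power_sum n) g"
  shows "\<exists>x. \<forall>i\<in>{1..n}. complex_ev.ev x (g i) = w i"
proof -
  obtain v where v: "\<And>x. \<forall>i\<in>{1..n}. complex_ev.ev x (sq_power_sum n i) = v i \<Longrightarrow>
      \<forall>i\<in>{1..n}. complex_ev.ev x (g i) = w i"
    using triangular_values[OF assms] by blast
  obtain e where e: "\<And>x. \<forall>i\<in>{1..n}. complex_ev.ev x (elem_sym n i sq_var) = e i \<Longrightarrow>
      \<forall>i\<in>{1..n}. complex_ev.ev x (sq_power_sum n i) = v i"
    using triangular_values_converse[OF triangular_elem_sym] by blast
  obtain y where y: "\<And>i. i \<in> {1..n} \<Longrightarrow> elem_sym n i y = e i"
    using elem_sym_surj by blast
  have "complex_ev.ev (\<lambda>i. csqrt (y i)) (elem_sym n i sq_var) = elem_sym n i y" for i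
    by (simp add: elem_sym_def complex_ev.ev_sum complex_ev.ev_prod complex_ev.ev_power sq_var_def)
  then show ?thesis
    using v e y by metis
qed

text \<open>A relation vanishes at every value of g, and by surjectivity these include all real
  vectors.\<close>

lemma triangular_algebraically_independent:
  assumes "triangular n (sq_power_sum n) g"
  shows "algebraically_independent n g"
  unfolding algebraically_independent_def
proof (intro ballI impI)
  fix q assume q: "q \<in> poly_ring n" "subst g q = 0"
  show "q = 0"
  proof (rule rpoly_zeroI)
    fix r :: "nat \<Rightarrow> real"
    obtain x where x: "\<forall>i\<in>{1..n}. complex_ev.ev x (g i) = of_real (r i)"
      using triangular_surj[OF assms, of "\<lambda>i. of_real (r i)"] by blast
    have "0 = complex_ev.ev (\<lambda>i. complex_ev.ev x (g i)) q"
      using q(2) complex_ev.ev_subst[of x g q] by simp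
    also have "\<dots> = complex_ev.ev (\<lambda>i. of_real (r i)) q"
      by (rule complex_ev.ev_cong) (use x q(1) in \<open>auto simp: poly_ring_def\<close>)
    finally show "real_ev.ev r q = 0"
      by (simp add: complex_ev_of_real)
  qed
qed

theorem theorem1p2:
  fixes n k :: nat
  assumes "n \<ge> 1" and "k \<in> {0..n}"
  shows "basis_of_invariants n (\<lambda>i. tau n k (2 * i))"
proof -
  let ?f = "\<lambda>i. tau n k (2 * i)"
  have k: "k \<le> n"
    using assms by simp
  note tri = triangular_tau[OF k]
  have P_inv: "generated_algebra (sq_power_sum n ` {1..n}) \<subseteq> W_invariants n"
    by (rule generated_algebra_subset_invariants) (auto intro: sq_power_sum_invariant)
  have f_inv: "?f ` {1..n} \<subseteq> W_invariants n"
  proof -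
    have "?f i \<in> generated_algebra (sq_power_sum n ` {1..n})" for i
      unfolding tau_eq[OF k]
      by (intro generated_algebra_sum generated_algebra.mult generated_algebra.Const mono_sym_in_algebra)
    then show ?thesis
      using P_inv by blast
  qed
  have "W_invariants n \<subseteq> generated_algebra (?f ` {1..n})"
    using W_invariants_subset generated_algebra_mono[of "sq_power_sum n ` {1..n}" "?f ` {1..n}"]
      triangular_generates[OF tri] by blast
  then have "generated_algebra (?f ` {1..n}) = W_invariants n"
    using generated_algebra_subset_invariants[OF f_inv] by blast
  then show ?thesis
    using f_inv homogeneous_tau[OF k] triangular_algebraically_independent[OF tri]
    unfolding basis_of_invariants_def by blast
qed

end
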